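(* Let $(X,T)$ be a topological dynamical system, and suppose that there is an ergodic $T$-invariant Borel probability measure $\mu$ on $X$ whose measure-theoretic (Kolmogorov--Sinai) entropy is $h_\mu(T)=+\infty$. Then $(X,T)$ is not hereditarily lowerable. In fact, there is a compact set $K\subset X$ such that $h(T,K)=+\infty$ and $h(T,L)\in\{0,+\infty\}$ for every nonempty compact set $L\subset K$.
   Context: A topological dynamical system $(X,T)$ is a compact metric space $X$ together with a homeomorphism $T\colon X\to X$. Logarithms are natural. For a finite open cover $\mathcal U$ of $X$, put $\mathcal U_0^{n-1}=\bigvee_{i=0}^{n-1}T^{-i}\mathcal U$ (the cover by all intersections $\bigcap_{i=0}^{n-1}T^{-i}U_i$ with $U_i\in\mathcal U$). For a compact set $K\subset X$ let $N(\mathcal U_0^{n-1},K)$ be the least number of members of $\mathcal U_0^{n-1}$ needed to cover $K$, and define $$h(T,\mathcal U,K)=\limsup_{n\to\infty}\frac1n\log N(\mathcal U_0^{n-1},K),\qquad h(T,K)=\sup_{\mathcal U}h(T,\mathcal U,K)\in[0,+\infty]$$ for nonempty $K$, the supremum being over finite open covers of $X$ (note $K$ need not be $T$-invariant). The system $(X,T)$ is hereditarily lowerable if for every nonempty compact set $K\subset X$ and every $0\leq h\leq h(T,K)$ there is a nonempty compact set $K_h\subset K$ with $h(T,K_h)=h$. *)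

theory Defs
  imports "HOL-Probability.Probability"
begin

text \<open>
  The space is a compact subset \<open>X\<close> of an arbitrary metric space type. The values of \<open>T\<close>
  outside \<open>X\<close> are irrelevant, and all topological and measurable notions are relative to \<open>X\<close>.
\<close>

definition topological_dynamical_system :: "'a::metric_space set \<Rightarrow> ('a \<Rightarrow> 'a) \<Rightarrow> bool" where
  "topological_dynamical_system X T \<longleftrightarrow> compact X \<and> (\<exists>S. homeomorphism X X T S)"

text \<open>
  The join of the families \<open>T\<^sup>-\<^sup>iU\<close> for \<open>i < n\<close>, used both for covers and for partitions.
  It is a set of sets, so different \<open>f\<close> giving the same intersection are counted once.
\<close>

definition iterated_join :: "'a set \<Rightarrow> ('a \<Rightarrow> 'a) \<Rightarrow> 'a set set \<Rightarrow> nat \<Rightarrow> 'a set set" where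
  "iterated_join X T U n = {{x \<in> X. \<forall>i<n. (T ^^ i) x \<in> f i} | f. \<forall>i<n. f i \<in> U}"

definition finite_open_cover :: "'a::topological_space set \<Rightarrow> 'a set set \<Rightarrow> bool" where
  "finite_open_cover X U \<longleftrightarrow>
     finite U \<and> (\<forall>A\<in>U. openin (top_of_set X) A) \<and> \<Union>U = X"

definition cover_number :: "'a set set \<Rightarrow> 'a set \<Rightarrow> nat" where
  "cover_number C K = (LEAST m. \<exists>F\<subseteq>C. finite F \<and> card F = m \<and> K \<subseteq> \<Union>F)"

definition cover_entropy ::
    "'a set \<Rightarrow> ('a \<Rightarrow> 'a) \<Rightarrow> 'a set set \<Rightarrow> 'a set \<Rightarrow> ereal" where
  "cover_entropy X T U K =
     limsup (\<lambda>n. ereal (ln (real (cover_number (iterated_join X T U n) K)) / real n))"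

text \<open>Only meaningful for nonempty \<open>K\<close>; for \<open>K = {}\<close> the convention \<open>ln 0 = 0\<close> yields \<open>0\<close>.\<close>

definition topological_entropy ::
    "'a::topological_space set \<Rightarrow> ('a \<Rightarrow> 'a) \<Rightarrow> 'a set \<Rightarrow> ereal" where
  "topological_entropy X T K = (SUP U\<in>{U. finite_open_cover X U}. cover_entropy X T U K)"

definition hereditarily_lowerable :: "'a::metric_space set \<Rightarrow> ('a \<Rightarrow> 'a) \<Rightarrow> bool" where
  "hereditarily_lowerable X T \<longleftrightarrow>
     (\<forall>K h. compact K \<and> K \<noteq> {} \<and> K \<subseteq> X \<and> 0 \<le> h \<and> h \<le> topological_entropy X T K \<longrightarrow>
        (\<exists>L. compact L \<and> L \<noteq> {} \<and> L \<subseteq> K \<and> topological_entropy X T L = h))"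

definition borel_probability_on :: "'a::topological_space set \<Rightarrow> 'a measure \<Rightarrow> bool" where
  "borel_probability_on X M \<longleftrightarrow> prob_space M \<and> sets M = sets (restrict_space borel X)"

definition invariant_measure :: "'a measure \<Rightarrow> ('a \<Rightarrow> 'a) \<Rightarrow> bool" where
  "invariant_measure M T \<longleftrightarrow> T \<in> measurable M M \<and> distr M M T = M"

definition ergodic_measure :: "'a measure \<Rightarrow> ('a \<Rightarrow> 'a) \<Rightarrow> bool" where
  "ergodic_measure M T \<longleftrightarrow> invariant_measure M T \<and>
     (\<forall>A\<in>sets M. T -` A \<inter> space M = A \<longrightarrow> measure M A = 0 \<or> measure M A = 1)"

definition finite_measurable_partition :: "'a measure \<Rightarrow> 'a set set \<Rightarrow> bool" where
  "finite_measurable_partition M P \<longleftrightarrow> finite P \<and> P \<subseteq> sets M \<and> partition_on (space M) P"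

text \<open>The convention \<open>0 ln 0 = 0\<close> holds since \<open>0 * y = 0\<close>.\<close>

definition partition_entropy :: "'a measure \<Rightarrow> 'a set set \<Rightarrow> real" where
  "partition_entropy M P = - (\<Sum>A\<in>P. measure M A * ln (measure M A))"

text \<open>For an invariant probability measure the limit exists by subadditivity.\<close>

definition measure_entropy_partition ::
    "'a measure \<Rightarrow> ('a \<Rightarrow> 'a) \<Rightarrow> 'a set set \<Rightarrow> ereal" where
  "measure_entropy_partition M T P =
     lim (\<lambda>n. ereal (partition_entropy M (iterated_join (space M) T P n) / real n))"

definition measure_entropy :: "'a measure \<Rightarrow> ('a \<Rightarrow> 'a) \<Rightarrow> ereal" where
  "measure_entropy M T =
     (SUP P\<in>{P. finite_measurable_partition M P}. measure_entropy_partition M T P)"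

end

theory Submission
  imports Defs
begin

text \<open>
  The set \<open>K\<close> is a Cantor-like set on which looking at a finer scale amounts to looking further into
  the future. It is the limit of a tree of closed sets with times \<open>t\<^sub>1 < t\<^sub>2 < \<dots>\<close> and scales \<open>\<epsilon>\<^sub>m\<close>. Level
  \<open>k\<close> has at least \<open>exp t\<^sub>k\<close> nodes. For every \<open>m < k\<close> the nodes of level \<open>k\<close> are told apart at scale
  \<open>\<epsilon>\<^sub>m\<close> by time \<open>t\<^sub>k / (m + 1)\<close>. On the other hand the points of \<open>K\<close> in one node of level \<open>k\<close> cannot be
  told apart at the \<open>j\<close>-th resolution before time \<open>t\<^bsub>k+1\<^esub> / d\<^sub>j\<close>, where \<open>d\<^sub>j\<close> does not depend on \<open>k \<ge> j\<close>.

  Let \<open>l\<^sub>k\<close> be the number of nodes of level \<open>k\<close> that meet a given \<open>L \<subseteq> K\<close>. If \<open>ln l\<^sub>k / t\<^sub>k \<rightarrow> 0\<close>, then for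
  every cover, with \<open>j\<close> chosen according to its Lebesgue number, \<open>l\<^sub>k\<close> members suffice at all times
  between \<open>t\<^sub>k / d\<^sub>j\<close> and \<open>t\<^bsub>k+1\<^esub> / d\<^sub>j\<close>, and the entropy of \<open>L\<close> is \<open>0\<close> (\<open>entropy_eq_0\<close>). Otherwise
  \<open>ln l\<^sub>k \<ge> c t\<^sub>k\<close> for infinitely many \<open>k\<close> and some \<open>c > 0\<close>; at scale \<open>\<epsilon>\<^sub>m\<close> this growth is visible \<open>m + 1\<close>
  times earlier, so that the entropy is at least \<open>(m + 1) c\<close> for every \<open>m\<close>, hence infinite
  (\<open>entropy_eq_infinity\<close>). The set \<open>K\<close> itself is in the second case, and a subset of
  entropy \<open>1\<close> does not exist.

  To grow the tree (\<open>refine_tree\<close>) one needs, in each of finitely many sets of positive measure, about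
  \<open>exp n\<close> points that are separated at scale \<open>\<epsilon>\<^sub>m\<close> by time \<open>n / (m + 1)\<close>, for all \<open>m \<le> k\<close> at once. A
  greedy choice finds them as soon as the Bowen balls of length \<open>n / (m + 1)\<close> and radius \<open>\<epsilon>\<^sub>m\<close> have
  measure at most \<open>exp (- 2 n)\<close> at most points. That the points of a node stay together for a long
  time is a matter of the pigeonhole principle: prescribing an orbit up to time \<open>n / d\<^sub>j\<close> at a fixed
  resolution costs a factor which is a small power of \<open>exp n\<close> when \<open>d\<^sub>j\<close> is large.

  The estimate on Bowen balls (\<open>prob_large_bowen_balls_tendsto_0\<close>) is the lower half of the Brin-Katok
  formula: for every \<open>h\<close> there is a radius \<open>e\<close> such that the points \<open>x\<close> whose Bowen ball of length \<open>n\<close> has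
  measure above \<open>exp (- h n)\<close> form a set whose measure tends to \<open>0\<close>. If it fails, ergodicity makes
  almost every orbit a concatenation of blocks that run in such heavy balls, up to a small proportion
  of single steps. As there are at most about \<open>exp (h n)\<close> disjoint heavy balls of length \<open>n\<close>, itineraries
  through a finite partition can then be encoded with at most \<open>h + 6\<close> nats per step
  (\<open>join_entropy_le_cover\<close>), which bounds the entropy of the partition. Since the entropy of the measure
  is infinite, there is a partition that violates the bound.
\<close>

section \<open>Weights on words, the Gibbs inequality and subadditivity\<close>

definition words :: "'b set \<Rightarrow> nat \<Rightarrow> 'b list set" where
  "words S n = {w. set w \<subseteq> S \<and> length w = n}"

lemma finite_words [simp]: "finite S \<Longrightarrow> finite (words S n)"
  using finite_lists_length_eq[of S n] by (simp add: words_def)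

lemma words_0 [simp]: "words S 0 = {[]}"
  by (auto simp: words_def)

lemma bij_betw_append_words:
  "bij_betw (\<lambda>(u, v). u @ v) (words S m \<times> words S n) (words S (m + n))"
proof (rule bij_betw_byWitness[where f' = "\<lambda>w. (take m w, drop m w)"])
  show "\<forall>a\<in>words S m \<times> words S n. (\<lambda>w. (take m w, drop m w)) (case a of (u, v) \<Rightarrow> u @ v) = a"
    by (auto simp: words_def)
  show "\<forall>a'\<in>words S (m + n). (case (take m a', drop m a') of (u, v) \<Rightarrow> u @ v) = a'"
    by auto
  show "(\<lambda>(u, v). u @ v) ` (words S m \<times> words S n) \<subseteq> words S (m + n)"
    by (auto simp: words_def)
  show "(\<lambda>w. (take m w, drop m w)) ` words S (m + n) \<subseteq> words S m \<times> words S n"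
    by (auto simp: words_def dest: in_set_takeD in_set_dropD)
qed

lemma sum_words_split:
  fixes f :: "'b list \<Rightarrow> 'c::comm_monoid_add"
  shows "(\<Sum>w\<in>words S (m + n). f w) = (\<Sum>u\<in>words S m. \<Sum>v\<in>words S n. f (u @ v))"
proof -
  have "(\<Sum>w\<in>words S (m + n). f w) = (\<Sum>a\<in>words S m \<times> words S n. f (case a of (u, v) \<Rightarrow> u @ v))"
    by (rule sum.reindex_bij_betw[OF bij_betw_append_words, symmetric])
  also have "\<dots> = (\<Sum>u\<in>words S m. \<Sum>v\<in>words S n. f (u @ v))"
    by (simp add: sum.cartesian_product case_prod_unfold)
  finally show ?thesis .
qed

lemma words_1: "words S (Suc 0) = (\<lambda>a. [a]) ` S"
  by (auto simp: words_def length_Suc_conv)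

lemma sum_words_1:
  fixes f :: "'b list \<Rightarrow> 'c::comm_monoid_add"
  shows "(\<Sum>w\<in>words S (Suc 0). f w) = (\<Sum>a\<in>S. f [a])"
  unfolding words_1 by (subst sum.reindex) (auto simp: inj_on_def)

text \<open>
  Unfolding the recursion gives the sum, over all ways of cutting the word into nonempty blocks, of
  the product of the weights of the blocks. It plays the part of a probability for a code in which a
  word is transmitted block by block.
\<close>

function parse_weight :: "('b list \<Rightarrow> real) \<Rightarrow> 'b list \<Rightarrow> real" where
  "parse_weight b w =
     (if w = [] then 1
      else \<Sum>n\<in>{1..length w}. b (take n w) * parse_weight b (drop n w))"
  by auto
termination
  by (relation "Wellfounded.measure (\<lambda>(b, w). length w)") auto

declare parse_weight.simps [simp del]

lemma parse_weight_nonneg: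
  assumes "\<And>u. 0 \<le> b u"
  shows "0 \<le> parse_weight b w"
proof (induction "length w" arbitrary: w rule: less_induct)
  case less
  show ?case
    using less assms by (subst parse_weight.simps) (auto intro!: sum_nonneg mult_nonneg_nonneg)
qed

lemma parse_weight_append:
  assumes "\<And>u. 0 \<le> b u" and "u \<noteq> []"
  shows "b u * parse_weight b v \<le> parse_weight b (u @ v)"
proof -
  let ?f = "\<lambda>n. b (take n (u @ v)) * parse_weight b (drop n (u @ v))"
  have "?f (length u) \<le> (\<Sum>n\<in>{1..length (u @ v)}. ?f n)"
    using assms
    by (intro member_le_sum) (auto intro!: mult_nonneg_nonneg parse_weight_nonneg simp: Suc_le_eq)
  then show ?thesis
    using assms(2) by (subst parse_weight.simps) simp
qed

text \<open>
  Kraft's inequality for such a code: splitting off the first block bounds the total weight of the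
  words of length \<open>N\<close> by the total weight of the possible first blocks, by induction.
\<close>

lemma sum_parse_weight_le_1:
  fixes b :: "'b list \<Rightarrow> real"
  assumes fin: "finite S" and nonneg: "\<And>u. 0 \<le> b u"
    and total: "\<And>N. (\<Sum>n\<in>{1..N}. \<Sum>u\<in>words S n. b u) \<le> 1"
  shows "(\<Sum>w\<in>words S N. parse_weight b w) \<le> 1"
proof (induction N rule: less_induct)
  case (less N)
  show ?case
  proof (cases "N = 0")
    case True
    then show ?thesis by (simp add: parse_weight.simps)
  next
    case False
    have "(\<Sum>w\<in>words S N. parse_weight b w)
        = (\<Sum>w\<in>words S N. \<Sum>n\<in>{1..N}. b (take n w) * parse_weight b (drop n w))"
      using False by (intro sum.cong refl, subst parse_weight.simps) (auto simp: words_def)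
    also have "\<dots> = (\<Sum>n\<in>{1..N}. \<Sum>w\<in>words S N. b (take n w) * parse_weight b (drop n w))"
      by (rule sum.swap)
    also have "\<dots> = (\<Sum>n\<in>{1..N}. (\<Sum>u\<in>words S n. b u) * (\<Sum>v\<in>words S (N - n). parse_weight b v))"
    proof (rule sum.cong[OF refl])
      fix n assume "n \<in> {1..N}"
      then have N: "N = n + (N - n)" by simp
      have "(\<Sum>w\<in>words S N. b (take n w) * parse_weight b (drop n w))
          = (\<Sum>u\<in>words S n. \<Sum>v\<in>words S (N - n).
               b (take n (u @ v)) * parse_weight b (drop n (u @ v)))"
        by (subst N, rule sum_words_split)
      also have "\<dots> = (\<Sum>u\<in>words S n. \<Sum>v\<in>words S (N - n). b u * parse_weight b v)"
        by (intro sum.cong refl) (auto simp: words_def)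
      also have "\<dots> = (\<Sum>u\<in>words S n. b u) * (\<Sum>v\<in>words S (N - n). parse_weight b v)"
        by (simp add: sum_product)
      finally show "(\<Sum>w\<in>words S N. b (take n w) * parse_weight b (drop n w)) = \<dots>" .
    qed
    also have "\<dots> \<le> (\<Sum>n\<in>{1..N}. (\<Sum>u\<in>words S n. b u) * 1)"
      using less nonneg by (intro sum_mono mult_left_mono) (auto intro!: sum_nonneg)
    also have "\<dots> \<le> 1" using total by simp
    finally show ?thesis .
  qed
qed

text \<open>
  Transition weights that sum to \<open>1\<close> for each input letter do so for each input word.
\<close>

lemma sum_prod_list_map2:
  fixes r :: "'b \<Rightarrow> 'b \<Rightarrow> real"
  assumes "\<And>a. a \<in> set e \<Longrightarrow> (\<Sum>c\<in>S. r a c) = 1"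
  shows "(\<Sum>u\<in>words S (length e). prod_list (map2 r e u)) = 1"
  using assms
proof (induction e)
  case (Cons a e)
  have "(\<Sum>u\<in>words S (length (a # e)). prod_list (map2 r (a # e) u))
      = (\<Sum>u\<in>words S (Suc 0 + length e). prod_list (map2 r (a # e) u))" by simp
  also have "\<dots> = (\<Sum>c\<in>S. \<Sum>v\<in>words S (length e). r a c * prod_list (map2 r e v))"
    unfolding sum_words_split sum_words_1 by simp
  also have "\<dots> = 1"
    using Cons by (simp flip: sum_distrib_left)
  finally show ?case .
qed simp

text \<open>
  Nonnegativity of relative entropy, from \<open>ln t \<le> t - 1\<close>. It is phrased with code lengths \<open>g\<close> rather
  than with \<open>- ln q\<close>, because \<open>ln 0 = 0\<close> would give the wrong length where \<open>q\<close> vanishes.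
\<close>

lemma Gibbs_inequality:
  fixes p q g :: "'b \<Rightarrow> real"
  assumes nonneg: "\<And>a. a \<in> A \<Longrightarrow> 0 \<le> p a" "\<And>a. a \<in> A \<Longrightarrow> 0 \<le> q a"
    and g: "\<And>a. a \<in> A \<Longrightarrow> 0 < p a \<Longrightarrow> exp (- g a) \<le> q a"
    and total: "sum q A \<le> sum p A"
  shows "(\<Sum>a\<in>A. - (p a * ln (p a))) \<le> (\<Sum>a\<in>A. p a * g a)"
proof -
  have "- (p a * ln (p a)) - p a * g a \<le> q a - p a" if "a \<in> A" for a
  proof (cases "p a = 0")
    case False
    then have p: "0 < p a"
      using nonneg(1)[OF that] by auto
    have "- (p a * ln (p a)) - p a * g a = p a * ln (exp (- g a) / p a)"
      using p by (simp add: ln_div algebra_simps)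
    also have "\<dots> \<le> p a * (exp (- g a) / p a - 1)"
      using p by (intro mult_left_mono ln_le_minus_one) auto
    also have "\<dots> = exp (- g a) - p a" using p by (simp add: field_simps)
    finally show ?thesis using g[OF that p] by simp
  qed (use nonneg(2)[OF that] in auto)
  then have "(\<Sum>a\<in>A. - (p a * ln (p a)) - p a * g a) \<le> (\<Sum>a\<in>A. q a - p a)"
    by (rule sum_mono)
  then show ?thesis using total unfolding sum_subtractf by linarith
qed

text \<open>
  Fekete's lemma: division of \<open>n\<close> by a fixed \<open>m\<close> bounds \<open>u n / n\<close> by \<open>u m / m\<close> up to a term that tends
  to \<open>0\<close>. The entropy of a partition is defined by means of \<open>lim\<close>, which says something only about
  sequences known to converge.
\<close>

lemma subadditive_convergent:
  fixes u :: "nat \<Rightarrow> real"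
  assumes sub: "\<And>m n. u (m + n) \<le> u m + u n" and nonneg: "\<And>n. 0 \<le> u n"
  shows "convergent (\<lambda>n. u n / real n)"
proof -
  define L where "L = (INF n\<in>{1..}. u n / real n)"
  have bdd: "bdd_below ((\<lambda>n. u n / real n) ` {1..})"
    by (rule bdd_belowI[of _ 0]) (auto simp: nonneg)
  have mult: "u (q * m + r) \<le> real q * u m + u r" for q m r
  proof (induction q)
    case (Suc q)
    then show ?case using sub[of m "q * m + r"] by (simp add: algebra_simps)
  qed simp
  have "(\<lambda>n. u n / real n) \<longlonglongrightarrow> L"
  proof (rule LIMSEQ_I)
    fix e :: real assume "0 < e"
    have "\<exists>x\<in>(\<lambda>n. u n / real n) ` {1..}. x < L + e / 2"
      using \<open>0 < e\<close> bdd cInf_less_iff[of "(\<lambda>n. u n / real n) ` {1..}" "L + e / 2"]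
      by (auto simp: L_def)
    then obtain m where m: "1 \<le> m" "u m / real m < L + e / 2" by auto
    define C where "C = (\<Sum>r<m. u r)"
    have C: "u r \<le> C" if "r < m" for r
      unfolding C_def using that by (intro member_le_sum) (auto simp: nonneg)
    obtain N where N: "C / (e / 2) < real N" using reals_Archimedean2 by blast
    have "norm (u n / real n - L) < e" if n: "max N 1 \<le> n" for n
    proof -
      have "u n \<le> real (n div m) * u m + u (n mod m)"
        using mult[of "n div m" m "n mod m"] by simp
      also have "\<dots> \<le> real n / real m * u m + C"
        using m C[of "n mod m"] nonneg[of m]
        by (intro add_mono mult_right_mono) (auto intro: of_nat_div_le_of_nat)
      finally have "u n / real n \<le> (real n / real m * u m + C) / real n"
        by (rule divide_right_mono) simp
      also have "\<dots> = u m / real m + C / real n" using n by (simp add: add_divide_distrib)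
      also have "C / real n < e / 2"
        using N n \<open>0 < e\<close> by (simp add: field_simps) (smt (verit) mult_left_mono of_nat_le_iff)
      finally have "u n / real n < L + e" using m by linarith
      moreover have "L \<le> u n / real n"
        unfolding L_def using n by (intro cINF_lower bdd) auto
      ultimately show ?thesis using \<open>0 < e\<close> by simp
    qed
    then show "\<exists>no. \<forall>n\<ge>no. norm (u n / real n - L) < e" by blast
  qed
  then show ?thesis by (rule convergentI)
qed

section \<open>Closed inner approximation of Borel sets\<close>

text \<open>
  The sets that can be squeezed between a closed and an open set with small difference form a
  \<open>\<sigma>\<close>-algebra, and it contains the closed sets since these are intersections of their metric
  neighbourhoods. The argument works in every metric space, unlike inner regularity by compact sets.
\<close>

lemma ex_closed_open_approx:
  fixes X :: "'a::metric_space set"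
  assumes fin: "finite_measure M" and sets_M: "sets M = sets (restrict_space borel X)" and X: "X \<in> sets borel"
    and B: "B \<in> sets borel" and e: "0 < (e::real)"
  shows "\<exists>C U. closed C \<and> open U \<and> C \<subseteq> B \<and> B \<subseteq> U \<and> measure M ((U - C) \<inter> X) < e"
proof -
  interpret finite_measure M by (rule fin)
  have meas [intro]: "D \<inter> X \<in> sets M" if "D \<in> sets borel" for D
    using that by (auto simp: sets_M sets_restrict_space)
  have "B \<in> sigma_sets UNIV (Collect closed)"
    using B by (simp add: borel_eq_closed)
  then show ?thesis
    using e
  proof (induction arbitrary: e)
    case (Basic C)
    then have C: "closed C" by simp
    show ?case
    proof (cases "C = {}")
      case True
      then show ?thesis using Basic by (intro exI[of _ "{}"]) auto
    next
      case False
      define U where "U j = {x. infdist x C < inverse (Suc j)}" for j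
      have open_U: "open (U j)" for j
        unfolding U_def by (intro open_Collect_less continuous_intros)
      have sub: "C \<subseteq> U j" for j
        by (auto simp: U_def)
      have "decseq (\<lambda>j. (U j - C) \<inter> X)"
      proof (rule antimonoI)
        fix i j :: nat assume "i \<le> j"
        then have "inverse (real (Suc j)) \<le> inverse (real (Suc i))"
          by (intro le_imp_inverse_le) auto
        then show "(U j - C) \<inter> X \<subseteq> (U i - C) \<inter> X"
          unfolding U_def by (auto simp del: inverse_le_iff_le of_nat_Suc intro: less_le_trans)
      qed
      moreover have "range (\<lambda>j. (U j - C) \<inter> X) \<subseteq> sets M"
        using open_U C by (auto intro!: meas)
      ultimately have "(\<lambda>j. measure M ((U j - C) \<inter> X)) \<longlonglongrightarrow> measure M (\<Inter>j. (U j - C) \<inter> X)"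
        by (intro finite_Lim_measure_decseq)
      also have "(\<Inter>j. (U j - C) \<inter> X) = {}"
      proof -
        have "x \<in> C" if "\<And>j. x \<in> U j" for x
        proof -
          have "infdist x C \<le> 0"
          proof (rule ccontr)
            assume "\<not> infdist x C \<le> 0"
            then obtain j where "inverse (Suc j) < infdist x C"
              using reals_Archimedean[of "infdist x C"] by auto
            then show False using that[of j] by (auto simp: U_def)
          qed
          then show ?thesis
            using C False in_closed_iff_infdist_zero[of C x] infdist_nonneg[of x C] by auto
        qed
        then show ?thesis by auto
      qed
      finally have "(\<lambda>j. measure M ((U j - C) \<inter> X)) \<longlonglongrightarrow> 0" by simp
      then have "\<forall>\<^sub>F j in sequentially. measure M ((U j - C) \<inter> X) < e"
        using Basic(2) by (rule order_tendstoD(2))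
      then obtain j where "measure M ((U j - C) \<inter> X) < e"
        by (auto dest: eventually_happens)
      then show ?thesis using C open_U sub by blast
    qed
  next
    case Empty
    then show ?case by (intro exI[of _ "{}"]) auto
  next
    case (Compl A)
    then obtain C U where CU: "closed C" "open U" "C \<subseteq> A" "A \<subseteq> U" "measure M ((U - C) \<inter> X) < e"
      using Compl.IH[OF Compl.prems] by blast
    have "(- C) - (- U) = U - C" by auto
    with CU have "closed (- U) \<and> open (- C) \<and> - U \<subseteq> UNIV - A \<and> UNIV - A \<subseteq> - C
        \<and> measure M ((- C - - U) \<inter> X) < e"
      by auto
    then show ?case by blast
  next
    case (Union A)
    have "\<exists>C U. closed C \<and> open U \<and> C \<subseteq> A j \<and> A j \<subseteq> U
        \<and> measure M ((U - C) \<inter> X) < e / 2 * (1 / 2) ^ Suc j" for j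
      using Union.prems by (intro Union.IH) simp
    then obtain C U where C: "\<And>j. closed (C j)" and U: "\<And>j. open (U j)"
      and sub: "\<And>j. C j \<subseteq> A j" "\<And>j. A j \<subseteq> U j"
      and small: "\<And>j. measure M ((U j - C j) \<inter> X) < e / 2 * (1 / 2) ^ Suc j"
      by metis
    \<comment> \<open>A countable union of closed sets need not be closed, so only finitely many are kept.\<close>
    define D where "D J = (\<Union>j<J. C j)" for J :: nat
    have closed_D: "closed (D J)" for J
      unfolding D_def using C by auto
    define R where "R J = ((\<Union>j. C j) - D J) \<inter> X" for J
    have "decseq R"
      unfolding R_def D_def by (rule antimonoI) auto
    moreover have "range R \<subseteq> sets M"
      unfolding R_def using C closed_D by (auto intro!: meas)
    ultimately have "(\<lambda>J. measure M (R J)) \<longlonglongrightarrow> measure M (\<Inter>J. R J)"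
      by (intro finite_Lim_measure_decseq)
    also have "(\<Inter>J. R J) = {}"
      by (auto simp: R_def D_def)
    finally have "(\<lambda>J. measure M (R J)) \<longlonglongrightarrow> 0" by simp
    then have "\<forall>\<^sub>F J in sequentially. measure M (R J) < e / 2"
      using Union(3) by (intro order_tendstoD(2)) auto
    then obtain J where J: "measure M (R J) < e / 2"
      by (auto dest: eventually_happens)
    have "(\<lambda>j. e / 2 * (1 / 2) ^ Suc j) sums (e / 2)"
      using sums_mult[OF power_half_series, of "e / 2"] by simp
    then have summ: "summable (\<lambda>j. e / 2 * (1 / 2) ^ Suc j)" and sum: "(\<Sum>j. e / 2 * (1 / 2) ^ Suc j) = e / 2"
      by (simp_all add: sums_iff)
    have summ': "summable (\<lambda>j. measure M ((U j - C j) \<inter> X))"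
      by (rule summable_comparison_test[OF _ summ]) (use small in \<open>auto intro!: exI[of _ 0] less_imp_le\<close>)
    have ms: "(U j - C j) \<inter> X \<in> sets M" for j using U C by auto
    have un: "(\<Union>j. (U j - C j) \<inter> X) \<in> sets M"
      by (rule sets.countable_UN) (use ms in blast)
    have "measure M (((\<Union>j. U j) - D J) \<inter> X) \<le> measure M ((\<Union>j. (U j - C j) \<inter> X) \<union> R J)"
      using ms U C closed_D by (intro finite_measure_mono) (auto simp: R_def intro!: sets.countable_UN meas)
    also have "\<dots> \<le> measure M (\<Union>j. (U j - C j) \<inter> X) + measure M (R J)"
      using un \<open>range R \<subseteq> sets M\<close> by (intro measure_Un_le) blast+
    also have "measure M (\<Union>j. (U j - C j) \<inter> X) \<le> (\<Sum>j. measure M ((U j - C j) \<inter> X))"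
      using ms summ' by (intro finite_measure_subadditive_countably) auto
    also have "\<dots> \<le> (\<Sum>j. e / 2 * (1 / 2) ^ Suc j)"
      using small by (intro suminf_le summ summ' less_imp_le)
    finally have "measure M (((\<Union>j. U j) - D J) \<inter> X) < e"
      using J sum by linarith
    moreover have "D J \<subseteq> (\<Union>j. A j)" "(\<Union>j. A j) \<subseteq> (\<Union>j. U j)" "open (\<Union>j. U j)"
      using sub U unfolding D_def by blast+
    ultimately show ?case
      using closed_D by (intro exI[of _ "D J"] exI[of _ "\<Union>j. U j"] conjI) auto
  qed
qed

lemma iterated_join_eq_words:
  "iterated_join X T U n = (\<lambda>w. {x \<in> X. \<forall>i<n. (T ^^ i) x \<in> w ! i}) ` words U n"
proof (intro equalityI subsetI)
  fix A assume "A \<in> iterated_join X T U n"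
  then obtain f where f: "A = {x \<in> X. \<forall>i<n. (T ^^ i) x \<in> f i}" "\<forall>i<n. f i \<in> U"
    by (auto simp: iterated_join_def)
  then show "A \<in> (\<lambda>w. {x \<in> X. \<forall>i<n. (T ^^ i) x \<in> w ! i}) ` words U n"
    by (intro image_eqI[of _ _ "map f [0..<n]"]) (auto simp: words_def)
next
  fix A assume "A \<in> (\<lambda>w. {x \<in> X. \<forall>i<n. (T ^^ i) x \<in> w ! i}) ` words U n"
  then obtain w where "w \<in> words U n" "A = {x \<in> X. \<forall>i<n. (T ^^ i) x \<in> w ! i}" by blast
  then show "A \<in> iterated_join X T U n"
    unfolding iterated_join_def by (auto simp: words_def subset_iff intro!: exI[of _ "\<lambda>i. w ! i"])
qed

section \<open>Ergodic systems and their Bowen balls\<close>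

locale ergodic_system = prob_space M
  for M :: "'a::metric_space measure" +
  fixes X :: "'a set" and T :: "'a \<Rightarrow> 'a"
  assumes compact_X: "compact X"
    and continuous_T: "continuous_on X T"
    and T_in: "x \<in> X \<Longrightarrow> T x \<in> X"
    and sets_M: "sets M = sets (restrict_space borel X)"
    and measurable_T [measurable]: "T \<in> measurable M M"
    and distr_T: "distr M M T = M"
    and ergodic: "A \<in> sets M \<Longrightarrow> T -` A \<inter> space M = A \<Longrightarrow> prob A = 0 \<or> prob A = 1"
begin

lemma space_M: "space M = X"
  using sets_eq_imp_space_eq[OF sets_M] by (simp add: space_restrict_space)

lemma X_sets [measurable]: "X \<in> sets M"
  using sets.top[of M] by (simp add: space_M)

lemma borel_X: "X \<in> sets borel"
  using compact_X by (intro borel_closed compact_imp_closed)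

lemma borel_Int_sets: "B \<in> sets borel \<Longrightarrow> B \<inter> X \<in> sets M"
  by (auto simp: sets_M sets_restrict_space)

lemma sets_imp_borel: "A \<in> sets M \<Longrightarrow> A \<in> sets borel"
  using borel_X by (auto simp: sets_M sets_restrict_space)

lemma openin_sets: "openin (top_of_set X) A \<Longrightarrow> A \<in> sets M"
  by (auto simp: openin_open Int_commute intro!: borel_Int_sets)

lemma closed_sets: "closed A \<Longrightarrow> A \<subseteq> X \<Longrightarrow> A \<in> sets M"
  using borel_Int_sets[of A] by (simp add: Int_absorb2)

lemma ex_closed_subset:
  assumes "A \<in> sets M" "0 < e"
  shows "\<exists>C. closed C \<and> C \<subseteq> A \<and> prob (A - C) < e"
proof -
  obtain C U where CU: "closed C" "open U" "C \<subseteq> A" "A \<subseteq> U" "measure M ((U - C) \<inter> X) < e"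
    using ex_closed_open_approx[OF finite_measure_axioms sets_M borel_X sets_imp_borel[OF assms(1)] assms(2)] by blast
  have "A - C \<subseteq> (U - C) \<inter> X"
    using CU sets.sets_into_space[OF assms(1)] by (auto simp: space_M)
  moreover have "(U - C) \<inter> X \<in> sets M"
    using CU by (intro borel_Int_sets) auto
  ultimately have "prob (A - C) \<le> prob ((U - C) \<inter> X)"
    by (rule finite_measure_mono)
  with CU show ?thesis by (intro exI[of _ C]) auto
qed

lemma T_pow_in: "x \<in> X \<Longrightarrow> (T ^^ i) x \<in> X"
  by (induction i) (auto simp: T_in)

lemma continuous_T_pow: "continuous_on X (T ^^ i)"
proof (induction i)
  case 0
  show ?case by (simp add: id_def)
next
  case (Suc i)
  then show ?case
    using T_pow_in continuous_on_compose[OF Suc, of T] continuous_on_subset[OF continuous_T, of "(T ^^ i) ` X"]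
    by auto
qed

lemma measurable_T_pow [measurable]: "T ^^ i \<in> measurable M M"
proof (induction i)
  case (Suc i)
  then show ?case using measurable_comp[OF Suc measurable_T] by simp
qed (simp add: id_def)

lemma distr_T_pow: "distr M M (T ^^ i) = M"
proof (induction i)
  case 0
  show ?case by (simp add: id_def distr_id2)
next
  case (Suc i)
  have "distr M M (T ^^ Suc i) = distr (distr M M (T ^^ i)) M T"
    by (simp add: distr_distr comp_def)
  then show ?case using Suc distr_T by metis
qed

lemma prob_vimage_T_pow: "A \<in> sets M \<Longrightarrow> prob ((T ^^ i) -` A \<inter> X) = prob A"
  using measure_distr[OF measurable_T_pow, of A i] by (simp add: distr_T_pow space_M)

lemma T_pow_vimage_sets: "A \<in> sets M \<Longrightarrow> (T ^^ i) -` A \<inter> X \<in> sets M"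
  using measurable_sets[OF measurable_T_pow, of A i] by (simp add: space_M)

text \<open>
  The preimages \<open>T\<^sup>-\<^sup>n B\<close> increase and have the same measure. Their union is strictly invariant, as the
  definition of ergodicity requires, and differs from \<open>B\<close> by a null set.
\<close>

lemma ergodic_subinvariant:
  assumes B: "B \<in> sets M" and sub: "\<And>x. x \<in> B \<Longrightarrow> T x \<in> B"
  shows "prob B = 0 \<or> prob B = 1"
proof -
  define C where "C n = (T ^^ n) -` B \<inter> X" for n
  have C: "C n \<in> sets M" for n
    unfolding C_def by (rule T_pow_vimage_sets[OF B])
  have B_X: "B \<subseteq> X" using sets.sets_into_space[OF B] by (simp add: space_M)
  have mono: "C n \<subseteq> C (Suc n)" for n
    using sub by (auto simp: C_def)
  have "(\<lambda>n. prob (C n)) \<longlonglongrightarrow> prob (\<Union>n. C n)"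
    using C mono by (intro finite_Lim_measure_incseq incseq_SucI) auto
  moreover have "prob (C n) = prob B" for n
    unfolding C_def by (rule prob_vimage_T_pow[OF B])
  ultimately have "prob (\<Union>n. C n) = prob B"
    by (simp add: LIMSEQ_const_iff)
  moreover have "T -` (\<Union>n. C n) \<inter> space M = (\<Union>n. C n)"
  proof -
    have "T -` C n \<inter> X = C (Suc n)" for n
      by (auto simp: C_def T_in funpow_Suc_right simp del: funpow.simps)
    then have "T -` (\<Union>n. C n) \<inter> space M = (\<Union>n. C (Suc n))"
      by (auto simp: space_M)
    also have "\<dots> = (\<Union>n. C n)"
      using mono by blast
    finally show ?thesis .
  qed
  ultimately show ?thesis
    using ergodic[of "\<Union>n. C n"] C by (auto intro!: sets.countable_UN)
qed

definition bowen_ball :: "nat \<Rightarrow> 'a \<Rightarrow> real \<Rightarrow> 'a set" where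
  "bowen_ball n x e = {y \<in> X. \<forall>i<n. dist ((T ^^ i) x) ((T ^^ i) y) < e}"

lemma openin_bowen_ball: "openin (top_of_set X) (bowen_ball n x e)"
proof (induction n)
  case 0
  show ?case by (simp add: bowen_ball_def)
next
  case (Suc n)
  have "bowen_ball (Suc n) x e = bowen_ball n x e \<inter> (X \<inter> (T ^^ n) -` ball ((T ^^ n) x) e)"
    by (auto simp: bowen_ball_def less_Suc_eq)
  moreover have "openin (top_of_set X) (X \<inter> (T ^^ n) -` ball ((T ^^ n) x) e)"
    using continuous_T_pow T_pow_in by (intro continuous_openin_preimage_gen) auto
  ultimately show ?case using Suc by auto
qed

lemma bowen_ball_sets [measurable]: "bowen_ball n x e \<in> sets M"
  by (rule openin_sets[OF openin_bowen_ball])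

lemma bowen_ball_self: "x \<in> X \<Longrightarrow> 0 < e \<Longrightarrow> x \<in> bowen_ball n x e"
  by (simp add: bowen_ball_def)

lemma bowen_ball_mono: "e \<le> e' \<Longrightarrow> bowen_ball n x e \<subseteq> bowen_ball n x e'"
  unfolding bowen_ball_def by fastforce

lemma bowen_ball_commute: "x \<in> X \<Longrightarrow> y \<in> bowen_ball n x e \<Longrightarrow> x \<in> bowen_ball n y e"
  by (auto simp: bowen_ball_def dist_commute)

lemma bowen_ball_triangle:
  assumes "y \<in> bowen_ball n x e" "z \<in> bowen_ball n y e'"
  shows "z \<in> bowen_ball n x (e + e')"
proof -
  have "dist ((T ^^ i) x) ((T ^^ i) z) < e + e'" if "i < n" for i
    using assms that dist_triangle[of "(T ^^ i) x" "(T ^^ i) z" "(T ^^ i) y"]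
    by (fastforce simp: bowen_ball_def)
  then show ?thesis using assms by (simp add: bowen_ball_def)
qed

text \<open>
  Lower semicontinuity of the measure of a Bowen ball in its centre: by continuity from below a
  slightly smaller ball still has measure above \<open>c\<close>, and it is contained in the balls of radius \<open>e\<close>
  around all nearby centres.
\<close>

lemma openin_large_bowen_ball:
  "openin (top_of_set X) {x \<in> X. c < prob (bowen_ball n x e)}"
proof (subst openin_subopen, intro ballI)
  fix x assume "x \<in> {x \<in> X. c < prob (bowen_ball n x e)}"
  then have x: "x \<in> X" "c < prob (bowen_ball n x e)" by auto
  define r where "r j = e - inverse (Suc j)" for j
  have "incseq (\<lambda>j. bowen_ball n x (r j))"
    by (intro monoI bowen_ball_mono) (auto simp: r_def intro!: le_imp_inverse_le)
  then have "(\<lambda>j. prob (bowen_ball n x (r j))) \<longlonglongrightarrow> prob (\<Union>j. bowen_ball n x (r j))"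
    by (intro finite_Lim_measure_incseq) auto
  also have "(\<Union>j. bowen_ball n x (r j)) = bowen_ball n x e"
  proof
    show "(\<Union>j. bowen_ball n x (r j)) \<subseteq> bowen_ball n x e"
      using bowen_ball_mono[of "r _" e] by (force simp: r_def)
    show "bowen_ball n x e \<subseteq> (\<Union>j. bowen_ball n x (r j))"
    proof
      fix y assume y: "y \<in> bowen_ball n x e"
      define a where "a = Max (insert (e - 1) ((\<lambda>i. dist ((T ^^ i) x) ((T ^^ i) y)) ` {..<n}))"
      have "a < e"
        unfolding a_def using y by (subst Max_less_iff) (auto simp: bowen_ball_def)
      then obtain j where j: "inverse (Suc j) < e - a"
        using reals_Archimedean[of "e - a"] by auto
      have "dist ((T ^^ i) x) ((T ^^ i) y) \<le> a" if "i < n" for i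
        unfolding a_def using that by (intro Max_ge) auto
      then have "y \<in> bowen_ball n x (r j)"
        using y j by (force simp: bowen_ball_def r_def)
      then show "y \<in> (\<Union>j. bowen_ball n x (r j))" by blast
    qed
  qed
  finally have "\<forall>\<^sub>F j in sequentially. c < prob (bowen_ball n x (r j))"
    using x(2) by (rule order_tendstoD(1))
  then obtain j where j: "c < prob (bowen_ball n x (r j))"
    by (auto dest: eventually_happens)
  define U where "U = bowen_ball n x (inverse (Suc j))"
  have "U \<subseteq> {x \<in> X. c < prob (bowen_ball n x e)}"
  proof
    fix y assume y: "y \<in> U"
    have "bowen_ball n x (r j) \<subseteq> bowen_ball n y e"
    proof
      fix z assume "z \<in> bowen_ball n x (r j)"
      with y bowen_ball_commute[OF x(1)] bowen_ball_triangle[of x n y "inverse (Suc j)" z "r j"]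
      show "z \<in> bowen_ball n y e" by (simp add: U_def r_def)
    qed
    then have "prob (bowen_ball n x (r j)) \<le> prob (bowen_ball n y e)"
      by (intro finite_measure_mono) auto
    with y j show "y \<in> {x \<in> X. c < prob (bowen_ball n x e)}"
      by (auto simp: U_def bowen_ball_def)
  qed
  moreover have "openin (top_of_set X) U" "x \<in> U"
    unfolding U_def using openin_bowen_ball x bowen_ball_self by auto
  ultimately show "\<exists>U. openin (top_of_set X) U \<and> x \<in> U \<and> U \<subseteq> {x \<in> X. c < prob (bowen_ball n x e)}"
    by blast
qed

lemma large_bowen_ball_sets [measurable]: "{x \<in> X. c < prob (bowen_ball n x e)} \<in> sets M"
  by (rule openin_sets[OF openin_large_bowen_ball])

end

section \<open>Entropy of itineraries\<close>

context ergodic_system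
begin

definition atom :: "'a set set \<Rightarrow> 'a \<Rightarrow> 'a set" where
  "atom P x = (THE A. A \<in> P \<and> x \<in> A)"

definition itinerary :: "'a set set \<Rightarrow> nat \<Rightarrow> 'a \<Rightarrow> 'a set list" where
  "itinerary P n x = map (\<lambda>i. atom P ((T ^^ i) x)) [0..<n]"

definition cylinder :: "'a set set \<Rightarrow> 'a set list \<Rightarrow> 'a set" where
  "cylinder P w = {x \<in> X. itinerary P (length w) x = w}"

lemma length_itinerary [simp]: "length (itinerary P n x) = n"
  by (simp add: itinerary_def)

lemma itinerary_append: "itinerary P (m + n) x = itinerary P m x @ itinerary P n ((T ^^ m) x)"
proof -
  have "(T ^^ (i + m)) x = (T ^^ i) ((T ^^ m) x)" for i
    by (simp add: funpow_add)
  then have "map (\<lambda>i. atom P ((T ^^ i) x)) [m..<m + n] = itinerary P n ((T ^^ m) x)"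
    unfolding itinerary_def by (simp add: map_add_upt[symmetric] add.commute[of m] comp_def del: map_add_upt)
  then show ?thesis
    by (simp add: itinerary_def upt_add_eq_append[of 0 m n])
qed

lemma expectation_T_pow:
  fixes f :: "'a \<Rightarrow> real"
  assumes "integrable M f"
  shows "integrable M (\<lambda>x. f ((T ^^ i) x))" "expectation (\<lambda>x. f ((T ^^ i) x)) = expectation f"
proof -
  have "f \<in> borel_measurable M" using assms by auto
  then show "expectation (\<lambda>x. f ((T ^^ i) x)) = expectation f"
    using integral_distr[OF measurable_T_pow, of f i] by (simp add: distr_T_pow)
  show "integrable M (\<lambda>x. f ((T ^^ i) x))"
    using integrable_distr[OF measurable_T_pow, of i f] assms by (simp add: distr_T_pow)
qed

context
  fixes P assumes P: "finite_measurable_partition M P"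
begin

lemma finite_P: "finite P" and P_sets: "A \<in> P \<Longrightarrow> A \<in> sets M"
  and Union_P: "\<Union>P = X" and disjoint_P: "A \<in> P \<Longrightarrow> B \<in> P \<Longrightarrow> x \<in> A \<Longrightarrow> x \<in> B \<Longrightarrow> A = B"
proof -
  have *: "finite P" "P \<subseteq> sets M" "\<Union>P = X" "disjoint P"
    using P by (auto simp: finite_measurable_partition_def partition_on_def space_M)
  show "finite P" "\<Union>P = X" by fact+
  show "A \<in> P \<Longrightarrow> A \<in> sets M" using * by blast
  show "A \<in> P \<Longrightarrow> B \<in> P \<Longrightarrow> x \<in> A \<Longrightarrow> x \<in> B \<Longrightarrow> A = B"
    using *(4) by (metis disjointD IntI empty_iff)
qed

lemma atom_eq: "A \<in> P \<Longrightarrow> x \<in> A \<Longrightarrow> atom P x = A"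
  unfolding atom_def by (rule the_equality) (auto dest: disjoint_P)

lemma atom_in: "x \<in> X \<Longrightarrow> atom P x \<in> P" and in_atom: "x \<in> X \<Longrightarrow> x \<in> atom P x"
proof -
  assume "x \<in> X"
  then obtain A where "A \<in> P" "x \<in> A" using Union_P by blast
  then show "atom P x \<in> P" "x \<in> atom P x" using atom_eq by simp_all
qed

lemma itinerary_in_words: "x \<in> X \<Longrightarrow> itinerary P n x \<in> words P n"
  by (auto simp: words_def itinerary_def atom_in T_pow_in)

lemma cylinder_eq: "w \<in> words P n \<Longrightarrow> cylinder P w = {x \<in> X. \<forall>i<n. (T ^^ i) x \<in> w ! i}"
proof -
  assume w: "w \<in> words P n"
  then have *: "length w = n" "\<And>i. i < n \<Longrightarrow> w ! i \<in> P"
    by (auto simp: words_def subset_iff)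
  have "itinerary P n x = w \<longleftrightarrow> (\<forall>i<n. (T ^^ i) x \<in> w ! i)" if "x \<in> X" for x
  proof -
    have "itinerary P n x = w \<longleftrightarrow> (\<forall>i<n. atom P ((T ^^ i) x) = w ! i)"
      using * by (auto simp: list_eq_iff_nth_eq itinerary_def)
    also have "\<dots> \<longleftrightarrow> (\<forall>i<n. (T ^^ i) x \<in> w ! i)"
      using * that by (metis atom_eq in_atom T_pow_in)
    finally show ?thesis .
  qed
  then show ?thesis using * by (auto simp: cylinder_def)
qed

lemma cylinder_sets: "w \<in> words P n \<Longrightarrow> cylinder P w \<in> sets M"
proof -
  assume w: "w \<in> words P n"
  have C: "(T ^^ i) -` (w ! i) \<inter> X \<in> sets M" if "i < n" for i
    using w that by (intro T_pow_vimage_sets P_sets) (auto simp: words_def subset_iff)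
  have "cylinder P w = X \<inter> (\<Inter>i\<in>{..<n}. (T ^^ i) -` (w ! i) \<inter> X)"
    unfolding cylinder_eq[OF w] by auto
  also have "\<dots> \<in> sets M"
  proof (cases "n = 0")
    case False
    then have "(\<Inter>i\<in>{..<n}. (T ^^ i) -` (w ! i) \<inter> X) \<in> sets M"
      by (intro sets.finite_INT C) auto
    then show ?thesis by (rule sets.Int[OF X_sets])
  qed simp
  finally show ?thesis .
qed

lemma iterated_join_eq: "iterated_join X T P n = cylinder P ` words P n"
  unfolding iterated_join_eq_words by (rule image_cong) (auto simp: cylinder_eq)

definition join_entropy :: "nat \<Rightarrow> real" where
  "join_entropy n = (\<Sum>w\<in>words P n. - (prob (cylinder P w) * ln (prob (cylinder P w))))"

text \<open>
  Only empty cylinders can belong to two words, and they contribute \<open>0 ln 0 = 0\<close>.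
\<close>

lemma partition_entropy_join: "partition_entropy M (iterated_join X T P n) = join_entropy n"
proof -
  have "(\<Sum>A\<in>cylinder P ` words P n. prob A * ln (prob A))
      = (\<Sum>w\<in>words P n. prob (cylinder P w) * ln (prob (cylinder P w)))"
  proof (subst sum.reindex_nontrivial)
    fix v w assume vw: "v \<in> words P n" "w \<in> words P n" "v \<noteq> w" "cylinder P v = cylinder P w"
    then have "cylinder P v = {}"
      by (auto simp: cylinder_def words_def)
    then show "prob (cylinder P v) * ln (prob (cylinder P v)) = 0" by simp
  qed (auto simp: finite_P)
  then show ?thesis
    unfolding partition_entropy_def iterated_join_eq join_entropy_def by (simp add: sum_negf)
qed

lemma
  fixes \<phi> :: "'a set list \<Rightarrow> real"
  shows integrable_itinerary: "integrable M (\<lambda>x. \<phi> (itinerary P n x))"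
    and expectation_itinerary:
      "expectation (\<lambda>x. \<phi> (itinerary P n x)) = (\<Sum>w\<in>words P n. prob (cylinder P w) * \<phi> w)"
proof -
  have eq: "\<phi> (itinerary P n x) = (\<Sum>w\<in>words P n. indicator (cylinder P w) x * \<phi> w)" if "x \<in> X" for x
  proof -
    have "(\<Sum>w\<in>words P n. indicator (cylinder P w) x * \<phi> w)
        = (\<Sum>w\<in>words P n. if itinerary P n x = w then \<phi> w else 0)"
      using that by (intro sum.cong refl) (auto simp: cylinder_def words_def)
    also have "\<dots> = \<phi> (itinerary P n x)"
      using itinerary_in_words[OF that] by (simp add: finite_P)
    finally show ?thesis by simp
  qed
  have int: "integrable M (\<lambda>x. \<Sum>w\<in>words P n. indicator (cylinder P w) x * \<phi> w)"
    by (intro Bochner_Integration.integrable_sum integrable_mult_left integrable_real_indicator)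
      (auto simp: cylinder_sets emeasure_eq_measure)
  then show "integrable M (\<lambda>x. \<phi> (itinerary P n x))"
    by (subst Bochner_Integration.integrable_cong[OF refl eq]) (auto simp: space_M)
  have "expectation (\<lambda>x. \<phi> (itinerary P n x))
      = expectation (\<lambda>x. \<Sum>w\<in>words P n. indicator (cylinder P w) x * \<phi> w)"
    by (intro Bochner_Integration.integral_cong eq) (auto simp: space_M)
  also have "\<dots> = (\<Sum>w\<in>words P n. expectation (\<lambda>x. indicator (cylinder P w) x * \<phi> w))"
    by (intro Bochner_Integration.integral_sum integrable_mult_left integrable_real_indicator)
      (auto simp: cylinder_sets emeasure_eq_measure)
  also have "\<dots> = (\<Sum>w\<in>words P n. prob (cylinder P w) * \<phi> w)"
    by (intro sum.cong refl) (auto simp: cylinder_sets dest!: cylinder_sets)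
  finally show "expectation (\<lambda>x. \<phi> (itinerary P n x)) = (\<Sum>w\<in>words P n. prob (cylinder P w) * \<phi> w)" .
qed

lemma sum_prob_cylinder: "(\<Sum>w\<in>words P n. prob (cylinder P w)) = 1"
  using expectation_itinerary[of "\<lambda>_. 1" n] prob_space by simp

text \<open>
  The mean length of a code for the itineraries of length \<open>n\<close> bounds their entropy.
\<close>

lemma join_entropy_le:
  assumes "\<And>w. w \<in> words P n \<Longrightarrow> 0 \<le> q w" "sum q (words P n) \<le> 1"
    and "\<And>w. w \<in> words P n \<Longrightarrow> 0 < prob (cylinder P w) \<Longrightarrow> exp (- g w) \<le> q w"
  shows "join_entropy n \<le> expectation (\<lambda>x. g (itinerary P n x))"
  unfolding join_entropy_def expectation_itinerary using assms
  by (intro Gibbs_inequality[where q = q]) (auto simp: sum_prob_cylinder)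

lemma join_entropy_nonneg: "0 \<le> join_entropy n"
  unfolding join_entropy_def 
proof (intro sum_nonneg)
  fix w
  show "0 \<le> - (prob (cylinder P w) * ln (prob (cylinder P w)))"
    by (cases "prob (cylinder P w) = 0") (auto simp: zero_less_measure_iff intro!: mult_nonneg_nonpos)
qed

text \<open>
  The first \<open>m\<close> and the last \<open>n\<close> letters are encoded independently of each other; by invariance the
  last letters are distributed like the first ones.
\<close>

lemma join_entropy_subadditive: "join_entropy (m + n) \<le> join_entropy m + join_entropy n"
proof -
  let ?p = "\<lambda>w. prob (cylinder P w)"
  have "join_entropy (m + n) \<le> expectation (\<lambda>x. (\<lambda>w. - ln (?p (take m w)) - ln (?p (drop m w))) (itinerary P (m + n) x))"
  proof (rule join_entropy_le[where q = "\<lambda>w. ?p (take m w) * ?p (drop m w)"])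
    have "(\<Sum>w\<in>words P (m + n). ?p (take m w) * ?p (drop m w))
        = (\<Sum>u\<in>words P m. \<Sum>v\<in>words P n. ?p u * ?p v)"
      unfolding sum_words_split by (intro sum.cong refl) (auto simp: words_def)
    also have "\<dots> = 1"
      by (simp add: sum_prob_cylinder flip: sum_distrib_left)
    finally show "(\<Sum>w\<in>words P (m + n). ?p (take m w) * ?p (drop m w)) \<le> 1" by simp
  next
    fix w assume w: "w \<in> words P (m + n)" and pos: "0 < ?p w"
    have uv: "take m w \<in> words P m" "drop m w \<in> words P n"
      using w by (auto simp: words_def dest: in_set_takeD in_set_dropD)
    have sub: "itinerary P m x = take m w \<and> itinerary P n ((T ^^ m) x) = drop m w"
      if "x \<in> cylinder P w" for x
    proof -
      have "itinerary P (m + n) x = w" using that w by (simp add: cylinder_def words_def)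
      then show ?thesis by (auto simp: itinerary_append)
    qed
    have "?p w \<le> ?p (take m w)"
      using sub uv w by (intro finite_measure_mono cylinder_sets) (auto simp: cylinder_def words_def)
    moreover have "?p w \<le> prob ((T ^^ m) -` cylinder P (drop m w) \<inter> X)"
      using sub uv w
      by (intro finite_measure_mono T_pow_vimage_sets cylinder_sets) (auto simp: cylinder_def words_def T_pow_in)
    ultimately have "0 < ?p (take m w)" "0 < ?p (drop m w)"
      using pos prob_vimage_T_pow[OF cylinder_sets[OF uv(2)], of m] by auto
    then show "exp (- (- ln (?p (take m w)) - ln (?p (drop m w)))) \<le> ?p (take m w) * ?p (drop m w)"
      by (simp add: exp_add)
  qed auto
  also have "\<dots> = expectation (\<lambda>x. - ln (?p (itinerary P m x)) + - ln (?p (itinerary P n ((T ^^ m) x))))"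
    by (simp add: itinerary_append)
  also have "\<dots> = expectation (\<lambda>x. - ln (?p (itinerary P m x))) + expectation (\<lambda>x. - ln (?p (itinerary P n ((T ^^ m) x))))"
    using integrable_itinerary[of "\<lambda>w. - ln (?p w)"] expectation_T_pow(1)
    by (intro Bochner_Integration.integral_add) auto
  also have "expectation (\<lambda>x. - ln (?p (itinerary P n ((T ^^ m) x)))) = expectation (\<lambda>x. - ln (?p (itinerary P n x)))"
    by (rule expectation_T_pow(2)[OF integrable_itinerary])
  finally show ?thesis
    unfolding expectation_itinerary[of "\<lambda>w. - ln (?p w)"] join_entropy_def by simp
qed

lemma measure_entropy_partition_le:
  assumes "\<And>n. join_entropy n \<le> real n * c + d"
  shows "measure_entropy_partition M T P \<le> ereal c"
proof -
  obtain L where L: "(\<lambda>n. join_entropy n / real n) \<longlonglongrightarrow> L"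
    using subadditive_convergent[OF join_entropy_subadditive join_entropy_nonneg]
    by (auto simp: convergent_def)
  have "(\<lambda>n. c + d / real n) \<longlonglongrightarrow> c + 0"
    by (intro tendsto_intros lim_const_over_n)
  moreover have "\<forall>\<^sub>F n in sequentially. join_entropy n / real n \<le> c + d / real n"
    using eventually_gt_at_top[of 0]
  proof eventually_elim
    case (elim n)
    then show ?case using assms[of n] by (simp add: field_simps)
  qed
  ultimately have "L \<le> c"
    using L by (intro tendsto_le[OF sequentially_bot]) auto
  moreover have "measure_entropy_partition M T P = ereal L"
    unfolding measure_entropy_partition_def space_M partition_entropy_join
    by (intro limI) (use L in simp)
  ultimately show ?thesis by simp
qed

end

end

section \<open>Measure of Bowen balls\<close>

context ergodic_system
begin

text \<open>
  A code for itineraries. An orbit that is outside \<open>D\<close> shadows, for some time \<open>n \<le> m\<close>, one of the at most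
  \<open>exp (h n)\<close> centres in \<open>E n\<close>; naming \<open>n\<close> and the centre costs at most \<open>h n + (n + 1) ln 2\<close>. Since the
  sets \<open>A p\<close> are further apart than the shadowing distance allows, the centre predicts the letter at
  each moment at which the orbit is outside \<open>R\<close>; confirming the prediction costs \<open>ln 2\<close>. In the
  remaining cases a letter is transmitted on its own, at cost \<open>ln (2 k)\<close> with \<open>k\<close> the number of
  letters, and the mean number of these cases is governed by the measures of \<open>D\<close> and \<open>R\<close>. The last
  letters, at most \<open>m\<close>, are also sent one by one.
\<close>

lemma join_entropy_le_cover:
  fixes A :: "'a set \<Rightarrow> 'a set" and E G :: "nat \<Rightarrow> 'a set"
  assumes P: "finite_measurable_partition M P"
    and sep: "\<And>p q x y. p \<in> P \<Longrightarrow> q \<in> P \<Longrightarrow> p \<noteq> q \<Longrightarrow> x \<in> A p \<Longrightarrow> y \<in> A q \<Longrightarrow> 4 * e \<le> dist x y"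
    and E: "\<And>n. finite (E n)" "\<And>n. real (card (E n)) \<le> exp (h * real n)"
    and cover: "\<And>n x. x \<in> G n \<Longrightarrow> \<exists>c\<in>E n. x \<in> bowen_ball n c (2 * e)"
    and h: "0 \<le> h"
    and D: "D \<in> sets M" "\<And>x. x \<in> X \<Longrightarrow> x \<notin> D \<Longrightarrow> \<exists>n\<in>{1..m}. x \<in> G n"
    and R: "R \<in> sets M" "\<And>x. x \<in> X \<Longrightarrow> x \<notin> R \<Longrightarrow> x \<in> A (atom P x)"
  shows "join_entropy P N
    \<le> real N * (h + 3 * ln 2 + ln (2 * real (card P)) * (prob D + prob R)) + real m * ln (2 * real (card P))"
proof -
  note fin = finite_P[OF P]
  obtain x0 where "x0 \<in> X" using not_empty by (auto simp: space_M)
  then have P_ne: "P \<noteq> {}" using atom_in[OF P] by blast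
  define k where "k = real (card P)"
  have k: "1 \<le> k"
    using P_ne fin by (simp add: k_def Suc_le_eq card_gt_0_iff)
  define L where "L = ln (2 * k)"
  have L: "0 \<le> L" "exp (- L) = 1 / (2 * k)"
    using k by (auto simp: L_def exp_minus inverse_eq_divide)
  \<comment> \<open>The letter predicted by a point near one of the sets \<open>A p\<close>, and an arbitrary letter elsewhere.\<close>
  define letter where "letter y = (if \<exists>p\<in>P. \<exists>z\<in>A p. dist y z < 2 * e
      then SOME p. p \<in> P \<and> (\<exists>z\<in>A p. dist y z < 2 * e) else SOME p. p \<in> P)" for y
  have letter_in: "letter y \<in> P" for y
  proof (cases "\<exists>p\<in>P. \<exists>z\<in>A p. dist y z < 2 * e")
    case True
    then have "\<exists>p. p \<in> P \<and> (\<exists>z\<in>A p. dist y z < 2 * e)" by blast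
    from someI_ex[OF this] True show ?thesis by (simp add: letter_def)
  qed (use P_ne in \<open>auto simp: letter_def some_in_eq\<close>)
  have letter_eq: "letter y = p" if "p \<in> P" "x \<in> A p" "dist y x < 2 * e" for x y p
  proof -
    have ex: "\<exists>p. p \<in> P \<and> (\<exists>z\<in>A p. dist y z < 2 * e)" using that by blast
    then have "letter y = (SOME p. p \<in> P \<and> (\<exists>z\<in>A p. dist y z < 2 * e))"
      by (auto simp: letter_def)
    with someI_ex[OF ex] obtain z where z: "letter y \<in> P" "z \<in> A (letter y)" "dist y z < 2 * e"
      by auto
    have "dist x z < 4 * e"
      using that z dist_triangle2[of x z y] by (simp add: dist_commute)
    then show ?thesis using sep[of p "letter y" x z] that z by force
  qed
  define code where "code n c = map (\<lambda>i. letter ((T ^^ i) c)) [0..<n]" for n c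
  \<comment> \<open>Half of the weight confirms the prediction, the other half is uniform on all letters.\<close>
  define r where "r a b = (if a = b then 1 / 2 else 0) + 1 / (2 * k)" for a b :: "'a set"
  have r_sum: "(\<Sum>b\<in>P. r a b) = 1" if "a \<in> P" for a
    using that fin k P_ne by (simp add: r_def sum.distrib k_def)
  have r_nonneg: "0 \<le> r a b" for a b
    using k by (simp add: r_def)
  \<comment> \<open>One half of the total weight goes to single letters and \<open>(1 / 2) ^ Suc n\<close> to the shadowing blocks of length \<open>n\<close>.\<close>
  define b where "b u = (if length u = 1 then 1 / (2 * k) else 0)
      + exp (- h * real (length u)) * (1 / 2) ^ Suc (length u)
        * (\<Sum>c\<in>E (length u). prod_list (map2 r (code (length u) c) u))" for u
  have map2_nonneg: "0 \<le> prod_list (map2 r v u)" for u v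
    by (induction v u rule: list_induct2') (auto simp: r_nonneg)
  have b_nonneg: "0 \<le> b u" for u
    unfolding b_def using k
    by (intro add_nonneg_nonneg mult_nonneg_nonneg sum_nonneg map2_nonneg) auto
  have b_sum: "(\<Sum>u\<in>words P n. b u) \<le> (if n = 1 then 1 / 2 else 0) + (1 / 2) ^ Suc n" for n
  proof -
    have "(\<Sum>u\<in>words P n. b u) = (\<Sum>u\<in>words P n. if n = 1 then 1 / (2 * k) else 0)
        + exp (- h * real n) * (1 / 2) ^ Suc n
          * (\<Sum>u\<in>words P n. \<Sum>c\<in>E n. prod_list (map2 r (code n c) u))"
      unfolding sum_distrib_left sum.distrib[symmetric]
      by (intro sum.cong refl) (auto simp: b_def words_def sum_distrib_left)
    also have "(\<Sum>u\<in>words P n. if n = 1 then 1 / (2 * k) else 0) = (if n = 1 then 1 / 2 else 0)"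
      using sum_words_1[of "\<lambda>_. 1 / (2 * k)" P] k by (simp add: k_def)
    also have "(\<Sum>u\<in>words P n. \<Sum>c\<in>E n. prod_list (map2 r (code n c) u))
        = (\<Sum>c\<in>E n. \<Sum>u\<in>words P (length (code n c)). prod_list (map2 r (code n c) u))"
      by (subst sum.swap) (simp add: code_def)
    also have "\<dots> = (\<Sum>c\<in>E n. 1)"
      by (intro sum.cong refl sum_prod_list_map2 r_sum) (auto simp: code_def letter_in)
    also have "exp (- h * real n) * (1 / 2) ^ Suc n * (\<Sum>c\<in>E n. 1)
        \<le> exp (- h * real n) * (1 / 2) ^ Suc n * exp (h * real n)"
      using E(2)[of n] by (intro mult_left_mono) auto
    also have "\<dots> = (1 / 2) ^ Suc n"
      by (simp add: mult.assoc mult.left_commute flip: exp_add)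
    finally show ?thesis by simp
  qed
  have b_total: "(\<Sum>n\<in>{1..N}. \<Sum>u\<in>words P n. b u) \<le> 1" for N
  proof -
    have "(\<Sum>n\<in>{1..N}. \<Sum>u\<in>words P n. b u)
        \<le> (\<Sum>n\<in>{1..N}. (if n = 1 then 1 / 2 else 0) + (1 / 2) ^ Suc n)"
      by (rule sum_mono[OF b_sum])
    also have "\<dots> = (\<Sum>n\<in>{1..N}. if n = 1 then 1 / 2 else 0) + (\<Sum>n\<in>{1..N}. (1 / 2) ^ Suc n)"
      by (rule sum.distrib)
    also have "(\<Sum>n\<in>{1..N}. (1 / 2 :: real) ^ Suc n) = 1 / 2 - (1 / 2) ^ Suc N"
      by (induction N) auto
    also have "(\<Sum>n\<in>{1..N}. if n = 1 then 1 / 2 else 0) \<le> (1 / 2 :: real)"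
      by (simp add: sum.delta)
    finally show ?thesis
      using zero_le_power[of "1 / 2 :: real" "Suc N"] by linarith
  qed
  define q where "q = parse_weight b"
  have q_append: "b u * q v \<le> q (u @ v)" if "u \<noteq> []" for u v
    unfolding q_def by (rule parse_weight_append[OF b_nonneg that])
  have q_nonneg: "0 \<le> q w" for w
    unfolding q_def by (rule parse_weight_nonneg[OF b_nonneg])
  have b_single: "exp (- L) \<le> b [a]" for a
    unfolding L(2) b_def by (simp add: sum_nonneg map2_nonneg)
  have q_single: "exp (- L) * q w \<le> q (a # w)" for a w
    using mult_right_mono[OF b_single[of a] q_nonneg[of w]] q_append[of "[a]" w] by simp
  have q_lower: "exp (- (real (length w) * L)) \<le> q w" for w
  proof (induction w)
    case Nil
    then show ?case by (simp add: q_def parse_weight.simps)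
  next
    case (Cons a w)
    have "exp (- (real (length (a # w)) * L)) = exp (- L) * exp (- (real (length w) * L))"
      by (simp add: algebra_simps flip: exp_add)
    also have "\<dots> \<le> exp (- L) * q w" using Cons by simp
    also have "\<dots> \<le> q (a # w)" by (rule q_single)
    finally show ?case .
  qed
  \<comment> \<open>The cost per step; \<open>3 ln 2\<close> is \<open>ln 2\<close> for the prediction and \<open>2 ln 2 \<ge> (n + 1) ln 2 / n\<close> for naming \<open>n\<close>.\<close>
  define g where "g x = h + 3 * ln 2 + L * (indicator D x + indicator R x)" for x
  have g_nonneg: "0 \<le> g x" for x
    using h L by (simp add: g_def)
  have prod_eq_prod_list: "(\<Prod>i<n. f i) = prod_list (map f [0..<n])" for f :: "nat \<Rightarrow> real" and n
    by (induction n) (simp_all add: mult.commute)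
  have b_block: "exp (- (\<Sum>i<n. g ((T ^^ i) x))) \<le> b (itinerary P n x)"
    if x: "x \<in> X" "x \<in> G n" and n: "1 \<le> n" for x n
  proof -
    obtain c where c: "c \<in> E n" "x \<in> bowen_ball n c (2 * e)" using cover x by blast
    have r_ge: "exp (- (ln 2 + L * indicator R ((T ^^ i) x))) \<le> r (letter ((T ^^ i) c)) (atom P ((T ^^ i) x))"
      if "i < n" for i
    proof (cases "(T ^^ i) x \<in> R")
      case True
      have "exp (- (ln 2 + L)) = 1 / 2 * exp (- L)"
        by (simp add: exp_diff exp_minus inverse_eq_divide)
      also have "\<dots> \<le> 1 / (2 * k)" using k unfolding L(2) by (simp add: field_simps)
      also have "\<dots> \<le> r (letter ((T ^^ i) c)) (atom P ((T ^^ i) x))" by (simp add: r_def)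
      finally show ?thesis using True by simp
    next
      case False
      then have "letter ((T ^^ i) c) = atom P ((T ^^ i) x)"
        using c that R(2)[OF T_pow_in[OF x(1)]] atom_in[OF P T_pow_in[OF x(1)]]
        by (intro letter_eq) (auto simp: bowen_ball_def)
      then show ?thesis using False k by (simp add: r_def exp_minus)
    qed
    have "exp (- (\<Sum>i<n. ln 2 + L * indicator R ((T ^^ i) x)))
        = (\<Prod>i<n. exp (- (ln 2 + L * indicator R ((T ^^ i) x))))"
      by (simp add: exp_sum flip: sum_negf)
    also have "\<dots> \<le> (\<Prod>i<n. r (letter ((T ^^ i) c)) (atom P ((T ^^ i) x)))"
      using r_ge by (intro prod_mono) auto
    also have "\<dots> = prod_list (map2 r (code n c) (itinerary P n x))"
      by (simp add: code_def itinerary_def zip_map_map zip_same_conv_map comp_def prod_eq_prod_list)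
    also have "\<dots> \<le> (\<Sum>c\<in>E n. prod_list (map2 r (code n c) (itinerary P n x)))"
      using c E(1) map2_nonneg by (intro member_le_sum) auto
    finally have 1: "exp (- (\<Sum>i<n. ln 2 + L * indicator R ((T ^^ i) x)))
        \<le> (\<Sum>c\<in>E n. prod_list (map2 r (code n c) (itinerary P n x)))" .
    have "exp (- (real n * (2 * ln 2))) = exp (real (n + n) * - ln 2 :: real)"
      by (simp add: algebra_simps)
    also have "\<dots> = (1 / 2) ^ (n + n)"
      unfolding exp_of_nat_mult by (simp add: exp_minus inverse_eq_divide)
    also have "\<dots> \<le> (1 / 2) ^ Suc n"
      using n by (intro power_decreasing) auto
    finally have 2: "exp (- (real n * (2 * ln 2))) \<le> (1 / 2 :: real) ^ Suc n" .
    have "(\<Sum>i<n. h + 3 * ln 2 + L * indicator R ((T ^^ i) x)) \<le> (\<Sum>i<n. g ((T ^^ i) x))"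
      using L(1) by (intro sum_mono) (simp add: g_def distrib_left)
    also have "(\<Sum>i<n. h + 3 * ln 2 + L * indicator R ((T ^^ i) x))
        = h * real n + real n * (2 * ln 2) + (\<Sum>i<n. ln 2 + L * indicator R ((T ^^ i) x))"
      by (simp add: sum.distrib algebra_simps)
    finally have "exp (- (\<Sum>i<n. g ((T ^^ i) x)))
        \<le> exp (- (h * real n + real n * (2 * ln 2) + (\<Sum>i<n. ln 2 + L * indicator R ((T ^^ i) x))))"
      by simp
    also have "\<dots> = exp (- h * real n) * exp (- (real n * (2 * ln 2)))
          * exp (- (\<Sum>i<n. ln 2 + L * indicator R ((T ^^ i) x)))"
      by (simp flip: exp_add)
    also have "\<dots> \<le> exp (- h * real n) * (1 / 2) ^ Suc n
          * (\<Sum>c\<in>E n. prod_list (map2 r (code n c) (itinerary P n x)))"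
      by (intro mult_mono 1 2) auto
    also have "\<dots> \<le> b (itinerary P n x)"
      unfolding b_def using k by simp
    finally show ?thesis .
  qed
  \<comment> \<open>The orbit is parsed greedily: a shadowing block whenever one starts, a single letter otherwise.\<close>
  have main: "exp (- ((\<Sum>i<N. g ((T ^^ i) x)) + real m * L)) \<le> q (itinerary P N x)" if "x \<in> X" for x
    using that
  proof (induction N arbitrary: x rule: less_induct)
    case (less N)
    consider "N \<le> m" | "m < N" "x \<in> D" | "m < N" "x \<notin> D" by linarith
    then show ?case
    proof cases
      case 1
      then have "real N * L \<le> (\<Sum>i<N. g ((T ^^ i) x)) + real m * L"
        using L(1) g_nonneg by (intro add_increasing sum_nonneg mult_right_mono) auto
      then have "exp (- ((\<Sum>i<N. g ((T ^^ i) x)) + real m * L)) \<le> exp (- (real N * L))"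
        by simp
      then show ?thesis
        using q_lower[of "itinerary P N x"] unfolding length_itinerary by (rule order_trans)
    next
      case 2
      then obtain N' where N': "N = Suc N'" by (cases N) auto
      have it: "itinerary P N x = atom P x # itinerary P N' (T x)"
        using itinerary_append[of P 1 N' x] by (simp add: N' itinerary_def)
      have "(\<Sum>i<N. g ((T ^^ i) x)) = g x + (\<Sum>i<N'. g ((T ^^ i) (T x)))"
        unfolding N' by (subst sum.lessThan_Suc_shift) (simp add: funpow_Suc_right del: funpow.simps(2))
      moreover have "L \<le> g x"
        using 2 h L by (simp add: g_def indicator_def)
      ultimately have "exp (- ((\<Sum>i<N. g ((T ^^ i) x)) + real m * L))
          \<le> exp (- L + - ((\<Sum>i<N'. g ((T ^^ i) (T x))) + real m * L))"
        by simp
      also have "\<dots> = exp (- L) * exp (- ((\<Sum>i<N'. g ((T ^^ i) (T x))) + real m * L))"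
        by (rule exp_add)
      also have "\<dots> \<le> exp (- L) * q (itinerary P N' (T x))"
        using less.IH[of N' "T x"] less.prems N' T_in by simp
      also have "\<dots> \<le> q (itinerary P N x)"
        unfolding it by (rule q_single)
      finally show ?thesis .
    next
      case 3
      then obtain n where n: "1 \<le> n" "n \<le> m" "x \<in> G n" using D(2)[OF less.prems 3(2)] by auto
      define N' where "N' = N - n"
      have N': "N = n + N'" "N' < N" using n 3 by (auto simp: N'_def)
      have "(\<Sum>i<N. g ((T ^^ i) x)) = (\<Sum>i<n. g ((T ^^ i) x)) + (\<Sum>i<N'. g ((T ^^ i) ((T ^^ n) x)))"
        unfolding N'(1) by (induction N') (simp_all add: funpow_add add.commute[of n])
      then have "exp (- ((\<Sum>i<N. g ((T ^^ i) x)) + real m * L))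
          = exp (- (\<Sum>i<n. g ((T ^^ i) x))) * exp (- ((\<Sum>i<N'. g ((T ^^ i) ((T ^^ n) x))) + real m * L))"
        by (simp flip: exp_add)
      also have "\<dots> \<le> b (itinerary P n x) * q (itinerary P N' ((T ^^ n) x))"
        using less.IH[OF N'(2), of "(T ^^ n) x"] less.prems n b_block T_pow_in b_nonneg
        by (intro mult_mono) auto
      also have "\<dots> \<le> q (itinerary P N x)"
        unfolding N'(1) itinerary_append using n(1) by (intro q_append) (auto simp: itinerary_def)
      finally show ?thesis .
    qed
  qed
  have q_pos: "0 < q w" for w
    by (rule less_le_trans[OF exp_gt_zero q_lower])
  have int_ind: "integrable M (\<lambda>x. indicator A x :: real)" if "A \<in> sets M" for A
    using that by (intro integrable_real_indicator) (auto simp: emeasure_eq_measure)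
  have int_g: "integrable M g"
    unfolding g_def using D(1) R(1) int_ind by (intro Bochner_Integration.integrable_add integrable_mult_right) auto
  have exp_g: "expectation g = h + 3 * ln 2 + L * (prob D + prob R)"
  proof -
    have "expectation g = expectation (\<lambda>x. h + 3 * ln 2) + L * (expectation (indicator D) + expectation (indicator R))"
      unfolding g_def using D(1) R(1) int_ind by (simp add: prob_space)
    then show ?thesis using D(1) R(1) by (simp add: prob_space)
  qed
  have "join_entropy P N \<le> expectation (\<lambda>x. - ln (q (itinerary P N x)))"
    using sum_parse_weight_le_1[OF fin b_nonneg b_total, of N] q_nonneg q_pos
    by (intro join_entropy_le[OF P, where q = q and g = "\<lambda>w. - ln (q w)"]) (auto simp: q_def)
  also have "\<dots> \<le> expectation (\<lambda>x. (\<Sum>i<N. g ((T ^^ i) x)) + real m * L)"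
  proof (rule integral_mono)
    show "integrable M (\<lambda>x. - ln (q (itinerary P N x)))"
      by (rule integrable_itinerary[OF P])
    show "integrable M (\<lambda>x. (\<Sum>i<N. g ((T ^^ i) x)) + real m * L)"
      by (intro Bochner_Integration.integrable_add Bochner_Integration.integrable_sum expectation_T_pow[OF int_g]) auto
    fix x assume "x \<in> space M"
    then have "- ((\<Sum>i<N. g ((T ^^ i) x)) + real m * L) \<le> ln (q (itinerary P N x))"
      using main[of x] q_pos[of "itinerary P N x"] by (simp only: space_M ln_ge_iff)
    then show "- ln (q (itinerary P N x)) \<le> (\<Sum>i<N. g ((T ^^ i) x)) + real m * L"
      by linarith
  qed
  also have "\<dots> = (\<Sum>i<N. expectation (\<lambda>x. g ((T ^^ i) x))) + real m * L"
    using expectation_T_pow(1)[OF int_g] by (simp add: prob_space)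
  also have "\<dots> = real N * expectation g + real m * L"
    using expectation_T_pow(2)[OF int_g] by simp
  finally show ?thesis unfolding exp_g L_def k_def by simp
qed

end

lemma ex_common_pos:
  fixes Q :: "'i \<Rightarrow> real \<Rightarrow> bool"
  assumes "finite I" "\<And>i. i \<in> I \<Longrightarrow> \<exists>d>0. Q i d" "\<And>i d d'. i \<in> I \<Longrightarrow> Q i d \<Longrightarrow> 0 < d' \<Longrightarrow> d' \<le> d \<Longrightarrow> Q i d'"
  shows "\<exists>d>0. \<forall>i\<in>I. Q i d"
proof -
  have "\<exists>d. \<forall>i\<in>I. 0 < d i \<and> Q i (d i)"
    by (rule bchoice) (use assms(2) in blast)
  then obtain d where d: "\<And>i. i \<in> I \<Longrightarrow> 0 < d i \<and> Q i (d i)" by blast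
  define m where "m = Min (insert 1 (d ` I))"
  have "0 < m" unfolding m_def using assms(1) d by (subst Min_gr_iff) auto
  moreover have "m \<le> d i" if "i \<in> I" for i
    unfolding m_def using assms(1) that by (intro Min_le) auto
  ultimately show ?thesis using d assms(3) by blast
qed

text \<open>
  The distance to the closed set attains its minimum on the compact one; unlike
  \<open>separate_compact_closed\<close> this does not rely on bounded closed sets being compact.
\<close>

lemma separate_compact_closed_metric:
  fixes S U :: "'a::metric_space set"
  assumes "compact S" "closed U" "S \<inter> U = {}"
  shows "\<exists>d>0. \<forall>x\<in>S. \<forall>y\<in>U. d \<le> dist x y"
proof (cases "S = {} \<or> U = {}")
  case False
  have "continuous_on S (\<lambda>x. infdist x U)" by (intro continuous_intros)
  then obtain x where x: "x \<in> S" "\<And>y. y \<in> S \<Longrightarrow> infdist x U \<le> infdist y U"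
    using continuous_attains_inf[OF assms(1)] False by blast
  have "infdist x U \<noteq> 0"
    using x(1) assms(2,3) False in_closed_iff_infdist_zero[of U x] by blast
  then have "0 < infdist x U" using infdist_nonneg[of x U] by linarith
  moreover have "infdist x U \<le> dist z y" if "z \<in> S" "y \<in> U" for z y
    using x(2)[OF that(1)] infdist_le[OF that(2), of z] by linarith
  ultimately show ?thesis by blast
qed (auto intro: exI[of _ 1])

context ergodic_system
begin

text \<open>
  The centres form a family, maximal in cardinality, of points with disjoint heavy balls: their number
  is bounded because the measures add up to at most \<open>1\<close>, and by maximality each further heavy ball
  meets one of the family.
\<close>

lemma ex_small_cover_of_large_bowen_balls:
  fixes n :: nat and h e :: real
  assumes e: "0 < e"
  defines "G \<equiv> {x \<in> X. exp (- (h * real n)) < prob (bowen_ball n x e)}"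
  shows "\<exists>E. finite E \<and> real (card E) \<le> exp (h * real n) \<and> (\<forall>x\<in>G. \<exists>c\<in>E. x \<in> bowen_ball n c (2 * e))"
proof -
  define S where "S F \<longleftrightarrow> finite F \<and> F \<subseteq> G \<and> disjoint_family_on (\<lambda>c. bowen_ball n c e) F" for F
  have bound: "real (card F) \<le> exp (h * real n)" if "S F" for F
  proof -
    have "real (card F) * exp (- (h * real n)) = (\<Sum>c\<in>F. exp (- (h * real n)))" by simp
    also have "\<dots> \<le> (\<Sum>c\<in>F. prob (bowen_ball n c e))"
      using that by (intro sum_mono) (auto simp: S_def G_def)
    also have "\<dots> = prob (\<Union>c\<in>F. bowen_ball n c e)"
      using that by (intro finite_measure_finite_Union[symmetric]) (auto simp: S_def)
    also have "\<dots> \<le> 1" by simp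
    finally show ?thesis by (simp add: exp_minus field_simps)
  qed
  have "card F < Suc (nat \<lceil>exp (h * real n)\<rceil>)" if "S F" for F
    using bound[OF that] real_nat_ceiling_ge[of "exp (h * real n)"] by linarith
  moreover have "S {}" by (simp add: S_def disjoint_family_on_def)
  ultimately obtain F where F: "S F" "\<And>F'. S F' \<Longrightarrow> card F' \<le> card F"
    using ex_has_greatest_nat[of S "{}" card "Suc (nat \<lceil>exp (h * real n)\<rceil>)"] by blast
  have "\<exists>c\<in>F. x \<in> bowen_ball n c (2 * e)" if x: "x \<in> G" for x
  proof (rule ccontr)
    assume far: "\<not> ?thesis"
    have x_X: "x \<in> X" using x by (simp add: G_def)
    have disj: "bowen_ball n x e \<inter> bowen_ball n c e = {}" if "c \<in> F" for c
    proof (rule ccontr)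
      assume "bowen_ball n x e \<inter> bowen_ball n c e \<noteq> {}"
      then obtain y where y: "y \<in> bowen_ball n x e" "y \<in> bowen_ball n c e" by blast
      have "x \<in> bowen_ball n c (e + e)"
        by (rule bowen_ball_triangle[OF y(2) bowen_ball_commute[OF x_X y(1)]])
      with far that show False by auto
    qed
    have "x \<notin> F"
    proof
      assume "x \<in> F"
      then show False using disj[of x] bowen_ball_self[OF x_X e, of n] by auto
    qed
    moreover have "S (insert x F)"
      using F(1) x disj \<open>x \<notin> F\<close> unfolding S_def by (auto simp: disjoint_family_on_insert)
    ultimately show False
      using F(1) F(2)[of "insert x F"] by (auto simp: S_def)
  qed
  then show ?thesis using F(1) bound[OF F(1)] by (auto simp: S_def)
qed

lemma prob_tendsto_0_of_limsup:
  assumes A: "\<And>n. A n \<in> sets M" and null: "prob (\<Inter>m. \<Union>n\<in>{m..}. A n) = 0"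
  shows "(\<lambda>n::nat. prob (A n)) \<longlonglongrightarrow> 0"
proof (rule tendsto_sandwich[of "\<lambda>_. 0"])
  have U: "(\<Union>n\<in>{m..}. A n) \<in> sets M" for m using A by blast
  have "(\<lambda>m. prob (\<Union>n\<in>{m..}. A n)) \<longlonglongrightarrow> prob (\<Inter>m. \<Union>n\<in>{m..}. A n)"
    using U by (intro finite_Lim_measure_decseq antimonoI UN_mono) auto
  then show "(\<lambda>m. prob (\<Union>n\<in>{m..}. A n)) \<longlonglongrightarrow> 0" using null by simp
  show "\<forall>\<^sub>F n in sequentially. prob (A n) \<le> prob (\<Union>n\<in>{n..}. A n)"
    using U by (intro always_eventually allI finite_measure_mono) auto
qed auto

text \<open>
  The lower bound of Brin and Katok for the decay of Bowen balls. The points at which it fails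
  infinitely often form a subinvariant set \<open>B\<close>. If \<open>B\<close> had full measure, almost every point would be the
  centre of a heavy ball of some length \<open>n \<ge> 1\<close>, and outside a set \<open>D m\<close> of small measure this length is
  at most \<open>m\<close>; then \<open>join_entropy_le_cover\<close> bounds the entropy of the partition \<open>P\<close> by \<open>h + 6\<close>.
  Of the \<open>6\<close>, one is spent on passing from \<open>h\<close> to \<open>h + 1\<close>, less than three on \<open>3 ln 2\<close>, and one each on
  \<open>D m\<close> and on the part \<open>R\<close> of the space not covered by the closed sets inside the atoms.
\<close>

lemma prob_large_bowen_balls_tendsto_0:
  assumes ent: "measure_entropy M T = \<infinity>" and h: "0 \<le> h"
  shows "\<exists>e>0. (\<lambda>n. prob {x \<in> X. exp (- (h * real n)) < prob (bowen_ball n x e)}) \<longlonglongrightarrow> 0"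
proof -
  have "ereal (h + 6) < measure_entropy M T" using ent by simp
  then obtain P where P: "finite_measurable_partition M P"
    and P_ent: "ereal (h + 6) < measure_entropy_partition M T P"
    unfolding measure_entropy_def less_SUP_iff by blast
  note fin = finite_P[OF P]
  define k where "k = real (card P)"
  obtain x0 where "x0 \<in> X" using not_empty by (auto simp: space_M)
  then have "P \<noteq> {}" using atom_in[OF P] by blast
  then have k: "1 \<le> k"
    using fin by (simp add: k_def Suc_le_eq card_gt_0_iff)
  define L where "L = ln (2 * k)"
  have L: "0 < L" using k by (simp add: L_def)
  have "\<exists>C. closed C \<and> C \<subseteq> p \<and> prob (p - C) < 1 / (k * L)" if "p \<in> P" for p
    using k L that by (intro ex_closed_subset P_sets[OF P]) auto
  then obtain A where A: "\<And>p. p \<in> P \<Longrightarrow> closed (A p)" "\<And>p. p \<in> P \<Longrightarrow> A p \<subseteq> p"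
    "\<And>p. p \<in> P \<Longrightarrow> prob (p - A p) < 1 / (k * L)" by metis
  have P_X: "p \<subseteq> X" if "p \<in> P" for p using that Union_P[OF P] by blast
  have A_sets: "A p \<in> sets M" if "p \<in> P" for p
    using A P_X that by (intro closed_sets) blast+
  define R where "R = X - (\<Union>p\<in>P. A p)"
  have R_sets: "R \<in> sets M"
    unfolding R_def using fin A_sets by (intro sets.Diff sets.finite_UN) auto
  have R_prob: "L * prob R \<le> 1"
  proof -
    have "prob R \<le> prob (\<Union>p\<in>P. p - A p)"
      using A_sets P_sets[OF P] fin Union_P[OF P]
      by (intro finite_measure_mono sets.finite_UN) (auto simp: R_def)
    also have "\<dots> \<le> (\<Sum>p\<in>P. prob (p - A p))"
      using A_sets P_sets[OF P] fin by (intro finite_measure_subadditive_finite) auto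
    also have "\<dots> \<le> (\<Sum>p\<in>P. 1 / (k * L))"
      using A(3) by (intro sum_mono less_imp_le)
    also have "\<dots> = 1 / L" using k by (simp add: k_def)
    finally show ?thesis using L by (simp add: field_simps)
  qed
  have R_in: "x \<in> A (atom P x)" if x: "x \<in> X" "x \<notin> R" for x
  proof -
    obtain p where p: "p \<in> P" "x \<in> A p" using x by (auto simp: R_def)
    then have "atom P x = p" using A(2) by (intro atom_eq[OF P]) auto
    with p show ?thesis by simp
  qed
  have "\<exists>e>0. \<forall>(p, q)\<in>{(p, q). p \<in> P \<and> q \<in> P \<and> p \<noteq> q}. \<forall>x\<in>A p. \<forall>y\<in>A q. 4 * e \<le> dist x y"
  proof (rule ex_common_pos)
    show "finite {(p, q). p \<in> P \<and> q \<in> P \<and> p \<noteq> q}"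
      by (rule finite_subset[of _ "P \<times> P"]) (use fin in auto)
    fix i assume "i \<in> {(p, q). p \<in> P \<and> q \<in> P \<and> p \<noteq> q}"
    then obtain p q where i: "i = (p, q)" "p \<in> P" "q \<in> P" "p \<noteq> q" by auto
    have "compact (A p)"
      using compact_Int_closed[OF compact_X A(1)[OF i(2)]] A(2)[OF i(2)] P_X[OF i(2)]
      by (simp add: Int_absorb1 subset_trans)
    moreover have "A p \<inter> A q = {}"
      using A(2) i disjoint_P[OF P] by blast
    ultimately obtain d where d: "0 < d" "\<forall>x\<in>A p. \<forall>y\<in>A q. d \<le> dist x y"
      using separate_compact_closed_metric[of "A p" "A q"] A(1)[OF i(3)] by blast
    show "\<exists>e>0. case i of (p, q) \<Rightarrow> \<forall>x\<in>A p. \<forall>y\<in>A q. 4 * e \<le> dist x y"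
      using d i by (intro exI[of _ "d / 4"]) auto
  next
    fix i and d d' :: real
    assume "case i of (p, q) \<Rightarrow> \<forall>x\<in>A p. \<forall>y\<in>A q. 4 * d \<le> dist x y" "d' \<le> d"
    then show "case i of (p, q) \<Rightarrow> \<forall>x\<in>A p. \<forall>y\<in>A q. 4 * d' \<le> dist x y"
      by (cases i) force
  qed
  then obtain e where e: "0 < e"
    and sep: "\<And>p q x y. p \<in> P \<Longrightarrow> q \<in> P \<Longrightarrow> p \<noteq> q \<Longrightarrow> x \<in> A p \<Longrightarrow> y \<in> A q \<Longrightarrow> 4 * e \<le> dist x y"
    by blast
  \<comment> \<open>A step of the orbit replaces \<open>n\<close> by \<open>n - 1\<close>, which changes \<open>exp (- h n)\<close> by a factor; the constant \<open>C\<close> absorbs it.\<close>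
  define B where "B = (\<Union>C::nat. \<Inter>m::nat. \<Union>n\<in>{m..}.
      {x \<in> X. exp (- (h * real n) - real C) < prob (bowen_ball n x e)})"
  have B_sets: "B \<in> sets M"
    unfolding B_def by (intro sets.countable_UN' sets.countable_INT' large_bowen_ball_sets) auto
  have in_B: "x \<in> B \<longleftrightarrow> x \<in> X \<and> (\<exists>C::nat. \<forall>m. \<exists>n\<ge>m. exp (- (h * real n) - real C) < prob (bowen_ball n x e))" for x
    by (simp add: B_def Bex_def)
  have "T x \<in> B" if x: "x \<in> B" for x
  proof -
    obtain C :: nat where x_X: "x \<in> X" and C: "\<forall>m. \<exists>n\<ge>m. exp (- (h * real n) - real C) < prob (bowen_ball n x e)"
      using x unfolding in_B by (elim conjE exE)
    define C' where "C' = C + nat \<lceil>h\<rceil>"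
    have "\<exists>n\<ge>m. exp (- (h * real n) - real C') < prob (bowen_ball n (T x) e)" for m
    proof -
      obtain n where n: "Suc m \<le> n" "exp (- (h * real n) - real C) < prob (bowen_ball n x e)"
        using C[rule_format, of "Suc m"] by blast
      then obtain n' where n': "n = Suc n'" "m \<le> n'" by (cases n) auto
      have "h \<le> real (nat \<lceil>h\<rceil>)" using h by (simp add: real_nat_ceiling_ge)
      then have "exp (- (h * real n') - real C') \<le> exp (- (h * real n) - real C)"
        by (simp add: n' C'_def algebra_simps)
      also have "\<dots> < prob (bowen_ball n x e)" by (rule n(2))
      also have "\<dots> \<le> prob ((T ^^ 1) -` bowen_ball n' (T x) e \<inter> X)"
      proof (intro finite_measure_mono T_pow_vimage_sets bowen_ball_sets subsetI)
        fix y assume y: "y \<in> bowen_ball n x e"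
        have "dist ((T ^^ i) (T x)) ((T ^^ i) (T y)) < e" if "i < n'" for i
          using y that n' by (auto simp: bowen_ball_def funpow_Suc_right simp del: funpow.simps(2) dest: spec[of _ "Suc i"])
        then show "y \<in> (T ^^ 1) -` bowen_ball n' (T x) e \<inter> X"
          using y T_in by (simp add: bowen_ball_def)
      qed
      also have "\<dots> = prob (bowen_ball n' (T x) e)"
        by (rule prob_vimage_T_pow[OF bowen_ball_sets])
      finally show ?thesis using n' by blast
    qed
    then show ?thesis using T_in[OF x_X] in_B[of "T x"] by metis
  qed
  then have "prob B = 0 \<or> prob B = 1" by (rule ergodic_subinvariant[OF B_sets])
  moreover have "prob B \<noteq> 1"
  proof
    assume B1: "prob B = 1"
    define G where "G n = {x \<in> X. exp (- ((h + 1) * real n)) < prob (bowen_ball n x e)}" for n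
    define D where "D m = X - (\<Union>n\<in>{1..m}. G n)" for m
    have D_sets: "D m \<in> sets M" for m
      unfolding D_def G_def by (intro sets.Diff sets.finite_UN X_sets large_bowen_ball_sets) auto
    have "B \<inter> (\<Inter>m. D m) = {}"
    proof (intro equals0I)
      fix x assume x: "x \<in> B \<inter> (\<Inter>m. D m)"
      then have D: "\<And>m. x \<in> D m" by blast
      from x have "x \<in> B" by blast
      then obtain C :: nat where x_X: "x \<in> X" and C: "\<forall>m. \<exists>n\<ge>m. exp (- (h * real n) - real C) < prob (bowen_ball n x e)"
        unfolding in_B by (elim conjE exE)
      \<comment> \<open>For \<open>n \<ge> C\<close> the constant is negligible against the passage from \<open>h\<close> to \<open>h + 1\<close>.\<close>
      obtain n where n: "Suc C \<le> n" "exp (- (h * real n) - real C) < prob (bowen_ball n x e)"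
        using C[rule_format, of "Suc C"] by blast
      have "exp (- ((h + 1) * real n)) \<le> exp (- (h * real n) - real C)"
        using n(1) by (simp add: algebra_simps)
      then have "exp (- ((h + 1) * real n)) < prob (bowen_ball n x e)"
        using n(2) by (rule le_less_trans)
      with x_X have "x \<in> G n" by (simp add: G_def)
      with D[of n] n(1) show False by (auto simp: D_def)
    qed
    then have "(\<Inter>m. D m) \<subseteq> space M - B"
      by (auto simp: D_def space_M)
    then have "prob (\<Inter>m. D m) \<le> prob (space M - B)"
      using B_sets by (intro finite_measure_mono) auto
    also have "\<dots> = 0" using B1 B_sets by (simp add: prob_compl)
    finally have "prob (\<Inter>m. D m) = 0" by (simp add: measure_le_0_iff)
    moreover have "(\<lambda>m. prob (D m)) \<longlonglongrightarrow> prob (\<Inter>m. D m)"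
      using D_sets by (intro finite_Lim_measure_decseq antimonoI) (auto simp: D_def)
    ultimately have "\<forall>\<^sub>F m in sequentially. prob (D m) < 1 / L"
      using L by (intro order_tendstoD(2)) auto
    then obtain m where m: "prob (D m) < 1 / L" by (auto dest: eventually_happens)
    have "\<exists>E. finite E \<and> real (card E) \<le> exp ((h + 1) * real n) \<and> (\<forall>x\<in>G n. \<exists>c\<in>E. x \<in> bowen_ball n c (2 * e))" for n
      unfolding G_def by (rule ex_small_cover_of_large_bowen_balls[OF e])
    then obtain E where E: "\<And>n. finite (E n)" "\<And>n. real (card (E n)) \<le> exp ((h + 1) * real n)"
      "\<And>n x. x \<in> G n \<Longrightarrow> \<exists>c\<in>E n. x \<in> bowen_ball n c (2 * e)" by metis
    have "L * prob (D m) \<le> 1"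
      using m L by (simp add: field_simps)
    then have cost: "h + 1 + 3 * ln 2 + L * (prob (D m) + prob R) \<le> h + 6"
      using R_prob ln2_le_25_over_36 unfolding distrib_left by linarith
    have "join_entropy P N \<le> real N * (h + 6) + real m * L" for N
    proof -
      have "join_entropy P N \<le> real N * (h + 1 + 3 * ln 2 + L * (prob (D m) + prob R)) + real m * L"
        unfolding L_def k_def
      proof (rule join_entropy_le_cover[OF P sep E _ D_sets _ R_sets R_in])
        fix x assume "x \<in> X" "x \<notin> D m"
        then show "\<exists>n\<in>{1..m}. x \<in> G n" by (auto simp: D_def)
      qed (use h in auto)
      also have "\<dots> \<le> real N * (h + 6) + real m * L"
        using cost by (intro add_right_mono mult_left_mono) auto
      finally show ?thesis .
    qed
    then have "measure_entropy_partition M T P \<le> ereal (h + 6)"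
      by (rule measure_entropy_partition_le[OF P])
    with P_ent show False by simp
  qed
  ultimately have "prob B = 0" by blast
  have "prob (\<Inter>m. \<Union>n\<in>{m..}. {x \<in> X. exp (- (h * real n)) < prob (bowen_ball n x e)}) \<le> prob B"
    by (intro finite_measure_mono[OF _ B_sets]) (auto simp: B_def intro!: exI[of _ "0 :: nat"])
  with \<open>prob B = 0\<close> have "prob (\<Inter>m. \<Union>n\<in>{m..}. {x \<in> X. exp (- (h * real n)) < prob (bowen_ball n x e)}) = 0"
    by (simp add: measure_le_0_iff)
  then have "(\<lambda>n. prob {x \<in> X. exp (- (h * real n)) < prob (bowen_ball n x e)}) \<longlonglongrightarrow> 0"
    by (intro prob_tendsto_0_of_limsup large_bowen_ball_sets)
  with e show ?thesis by blast
qed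

end

section \<open>Growing the tree\<close>

context ergodic_system
begin

lemma pigeonhole_step:
  assumes W: "W \<in> sets M" and U: "finite U" "U \<subseteq> sets M" "X = \<Union>U"
  shows "\<exists>u\<in>U. prob W \<le> real (card U) * prob (W \<inter> (T ^^ i) -` u)"
proof (rule ccontr)
  assume "\<not> ?thesis"
  then have neg: "\<And>u. u \<in> U \<Longrightarrow> real (card U) * prob (W \<inter> (T ^^ i) -` u) < prob W" by force
  have W_X: "W \<subseteq> X" using sets.sets_into_space[OF W] by (simp add: space_M)
  have U_ne: "U \<noteq> {}" using U(3) not_empty by (auto simp: space_M)
  have S: "W \<inter> (T ^^ i) -` u \<in> sets M" if "u \<in> U" for u
  proof -
    have "W \<inter> ((T ^^ i) -` u \<inter> X) \<in> sets M"
      using U(2) that by (intro sets.Int W T_pow_vimage_sets) auto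
    moreover have "W \<inter> ((T ^^ i) -` u \<inter> X) = W \<inter> (T ^^ i) -` u" using W_X by blast
    ultimately show ?thesis by simp
  qed
  have card: "0 < real (card U)" using U(1) U_ne by (simp add: card_gt_0_iff)
  have "(T ^^ i) x \<in> \<Union>U" if "x \<in> W" for x using T_pow_in[of x i] W_X U(3) that by auto
  then have "W \<subseteq> (\<Union>u\<in>U. W \<inter> (T ^^ i) -` u)" by auto
  then have "prob W \<le> prob (\<Union>u\<in>U. W \<inter> (T ^^ i) -` u)"
    using S U(1) by (intro finite_measure_mono sets.finite_UN) auto
  also have "\<dots> \<le> (\<Sum>u\<in>U. prob (W \<inter> (T ^^ i) -` u))"
    using S U(1) by (intro finite_measure_subadditive_finite) auto
  also have "\<dots> < (\<Sum>u\<in>U. prob W / real (card U))"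
    using neg card U(1) U_ne by (intro sum_strict_mono) (auto simp: field_simps)
  also have "\<dots> = prob W" using card by simp
  finally show False by simp
qed

lemma pigeonhole_orbit:
  assumes W: "W \<in> sets M" and U: "finite U" "U \<subseteq> sets M" "X = \<Union>U"
  shows "\<exists>W'\<in>sets M. W' \<subseteq> W \<and> prob W \<le> real (card U) ^ n * prob W'
    \<and> (\<forall>i<n. \<exists>u\<in>U. \<forall>x\<in>W'. (T ^^ i) x \<in> u)"
proof (induction n)
  case 0
  show ?case using W by auto
next
  case (Suc n)
  then obtain W' where W': "W' \<in> sets M" "W' \<subseteq> W" "prob W \<le> real (card U) ^ n * prob W'"
    "\<And>i. i < n \<Longrightarrow> \<exists>u\<in>U. \<forall>x\<in>W'. (T ^^ i) x \<in> u" by auto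
  obtain u where u: "u \<in> U" "prob W' \<le> real (card U) * prob (W' \<inter> (T ^^ n) -` u)"
    using pigeonhole_step[OF W'(1) U] by blast
  have W'_X: "W' \<subseteq> X" using sets.sets_into_space[OF W'(1)] by (simp add: space_M)
  have "W' \<inter> ((T ^^ n) -` u \<inter> X) \<in> sets M"
    using U(2) u(1) by (intro sets.Int W' T_pow_vimage_sets) auto
  moreover have "W' \<inter> ((T ^^ n) -` u \<inter> X) = W' \<inter> (T ^^ n) -` u" using W'_X by blast
  ultimately have "W' \<inter> (T ^^ n) -` u \<in> sets M" by simp
  moreover have "prob W \<le> real (card U) ^ Suc n * prob (W' \<inter> (T ^^ n) -` u)"
    using order_trans[OF W'(3) mult_left_mono[OF u(2) zero_le_power[OF of_nat_0_le_iff]]] by (simp add: mult_ac)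
  moreover have "\<exists>u'\<in>U. \<forall>x\<in>W' \<inter> (T ^^ n) -` u. (T ^^ i) x \<in> u'" if "i < Suc n" for i
  proof (cases "i = n")
    case True
    then show ?thesis using u(1) by (intro bexI[of _ u]) auto
  next
    case False
    then have "i < n" using that by simp
    from W'(4)[OF this] show ?thesis by blast
  qed
  ultimately show ?case using W'(2) by (intro bexI[of _ "W' \<inter> (T ^^ n) -` u"]) auto
qed

text \<open>
  Orbits are localised at several resolutions \<open>U j\<close>, each up to its own time \<open>n j\<close>; every time step at
  resolution \<open>j\<close> costs a factor \<open>card (U j)\<close>.
\<close>

lemma pigeonhole_scales:
  fixes U :: "nat \<Rightarrow> 'a set set" and n :: "nat \<Rightarrow> nat"
  assumes W: "W \<in> sets M" and U: "\<And>j. finite (U j)" "\<And>j. U j \<subseteq> sets M" "\<And>j. X = \<Union>(U j)"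
  shows "\<exists>W'\<in>sets M. W' \<subseteq> W \<and> prob W \<le> (\<Prod>j<k. real (card (U j)) ^ n j) * prob W'
    \<and> (\<forall>j<k. \<forall>i<n j. \<exists>u\<in>U j. \<forall>x\<in>W'. (T ^^ i) x \<in> u)"
proof (induction k)
  case 0
  show ?case using W by auto
next
  case (Suc k)
  then obtain W' where W': "W' \<in> sets M" "W' \<subseteq> W" "prob W \<le> (\<Prod>j<k. real (card (U j)) ^ n j) * prob W'"
    "\<And>j i. j < k \<Longrightarrow> i < n j \<Longrightarrow> \<exists>u\<in>U j. \<forall>x\<in>W'. (T ^^ i) x \<in> u" by auto
  obtain W'' where W'': "W'' \<in> sets M" "W'' \<subseteq> W'" "prob W' \<le> real (card (U k)) ^ n k * prob W''"
    "\<And>i. i < n k \<Longrightarrow> \<exists>u\<in>U k. \<forall>x\<in>W''. (T ^^ i) x \<in> u"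
    using pigeonhole_orbit[OF W'(1) U, of k "n k"] by auto
  have "prob W \<le> (\<Prod>j<Suc k. real (card (U j)) ^ n j) * prob W''"
    using order_trans[OF W'(3) mult_left_mono[OF W''(3)]] by (simp add: prod_nonneg mult_ac)
  moreover have "\<exists>u\<in>U j. \<forall>x\<in>W''. (T ^^ i) x \<in> u" if "j < Suc k" "i < n j" for i j
  proof (cases "j = k")
    case True
    then show ?thesis using that(2) W''(4) by blast
  next
    case False
    then have "j < k" using that by simp
    from W'(4)[OF this that(2)] W''(2) show ?thesis by blast
  qed
  ultimately show ?case using W'(2) W''(1,2) by (intro bexI[of _ W'']) auto
qed

text \<open>
  A greedy choice: the points already chosen forbid a set of measure at most \<open>c * b\<close>, which does not
  exhaust the next \<open>W i\<close>.
\<close>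

lemma ex_separated_points:
  assumes "finite I" and "real (card I) \<le> c" and b: "0 \<le> b"
    and W: "\<And>i. i \<in> I \<Longrightarrow> W i \<in> sets M" "\<And>i. i \<in> I \<Longrightarrow> c * b < prob (W i)"
    and B: "\<And>x. B x \<in> sets M" "\<And>i x. i \<in> I \<Longrightarrow> x \<in> W i \<Longrightarrow> prob (B x) \<le> b"
    and sym: "\<And>x y. x \<in> X \<Longrightarrow> y \<in> B x \<Longrightarrow> x \<in> B y"
  shows "\<exists>p. (\<forall>i\<in>I. p i \<in> W i) \<and> (\<forall>i\<in>I. \<forall>j\<in>I. i \<noteq> j \<longrightarrow> p i \<notin> B (p j))"
  using assms(1,2) W B(2)
proof (induction I rule: finite_induct)
  case (insert i I)
  have "real (card I) \<le> c" using insert.prems(1) insert.hyps by simp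
  then obtain p where p: "\<And>i. i \<in> I \<Longrightarrow> p i \<in> W i" "\<And>i j. i \<in> I \<Longrightarrow> j \<in> I \<Longrightarrow> i \<noteq> j \<Longrightarrow> p i \<notin> B (p j)"
    using insert.IH insert.prems by (metis insertI2)
  have "prob (\<Union>j\<in>I. B (p j)) \<le> (\<Sum>j\<in>I. prob (B (p j)))"
    using B(1) insert.hyps by (intro finite_measure_subadditive_finite) auto
  also have "\<dots> \<le> (\<Sum>j\<in>I. b)"
    using p(1) insert.prems(4) by (intro sum_mono) blast
  also have "\<dots> \<le> c * b"
    using \<open>real (card I) \<le> c\<close> b by (simp add: mult_right_mono)
  also have "\<dots> < prob (W i)" using insert.prems by simp
  finally have less: "prob (\<Union>j\<in>I. B (p j)) < prob (W i)" .
  have "\<not> W i \<subseteq> (\<Union>j\<in>I. B (p j))"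
  proof
    assume "W i \<subseteq> (\<Union>j\<in>I. B (p j))"
    then have "prob (W i) \<le> prob (\<Union>j\<in>I. B (p j))"
      using B(1) insert.hyps by (intro finite_measure_mono sets.finite_UN) auto
    with less show False by simp
  qed
  then obtain x where x: "x \<in> W i" "\<And>j. j \<in> I \<Longrightarrow> x \<notin> B (p j)" by blast
  have "p j \<notin> B x" if "j \<in> I" for j
  proof
    assume "p j \<in> B x"
    moreover have "x \<in> X"
      using x(1) sets.sets_into_space[OF insert.prems(2)[of i]] by (auto simp: space_M)
    ultimately show False using sym x(2) that by blast
  qed
  with p x insert.hyps show ?case
    by (intro exI[of _ "p(i := x)"]) (auto simp: fun_upd_def)
qed simp

lemma T_pow_uniformly_continuous:
  assumes "0 < e"
  shows "\<exists>r>0. \<forall>i<n. \<forall>x\<in>X. \<forall>y\<in>X. dist x y \<le> r \<longrightarrow> dist ((T ^^ i) x) ((T ^^ i) y) \<le> e"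
proof -
  have "\<exists>r>0. \<forall>i\<in>{..<n}. \<forall>x\<in>X. \<forall>y\<in>X. dist x y \<le> r \<longrightarrow> dist ((T ^^ i) x) ((T ^^ i) y) \<le> e"
  proof (rule ex_common_pos)
    fix i
    have "uniformly_continuous_on X (T ^^ i)"
      by (rule compact_uniformly_continuous[OF continuous_T_pow compact_X])
    then obtain r where r: "0 < r" "\<And>x y. x \<in> X \<Longrightarrow> y \<in> X \<Longrightarrow> dist y x < r \<Longrightarrow> dist ((T ^^ i) y) ((T ^^ i) x) < e"
      using assms unfolding uniformly_continuous_on_def by metis
    show "\<exists>r>0. \<forall>x\<in>X. \<forall>y\<in>X. dist x y \<le> r \<longrightarrow> dist ((T ^^ i) x) ((T ^^ i) y) \<le> e"
      using r(1) r(2) by (intro exI[of _ "r / 2"]) (auto intro: less_imp_le)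
  qed auto
  then show ?thesis by auto
qed

text \<open>
  In each \<open>V\<close> of the given family, three reductions lead to a set \<open>W V\<close> of measure at least
  \<open>v / 2 * exp (- n / 2)\<close>: points with heavy Bowen balls are removed, the pigeonhole principle makes all
  orbits in \<open>W V\<close> close to each other until time \<open>n div d j\<close>, and points with a null neighbourhood in \<open>V\<close>
  are discarded. The Bowen balls of the remaining points have measure at most \<open>exp (- 2 n)\<close>, so that
  about \<open>exp n\<close> separated points can be selected in every \<open>W V\<close>. The new sets are the intersections of \<open>V\<close>
  with small balls around these points: the balls preserve separation and closeness up to an error of
  \<open>2 \<eta>\<close>, and the last reduction ensures that their traces on \<open>V\<close> have positive measure. The radius is fixed before the
  points are, because it depends only on \<open>n\<close> and \<open>\<eta>\<close>.
\<close>

lemma refine_tree: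
  fixes eps :: "nat \<Rightarrow> real" and d :: "nat \<Rightarrow> nat" and U :: "nat \<Rightarrow> 'a set set" and F :: "'a set set"
  assumes eps: "\<And>m. 0 < eps m"
    and small: "\<And>m. (\<lambda>n. prob {x \<in> X. exp (- (3 * real (Suc m) * real n)) < prob (bowen_ball n x (eps m))}) \<longlonglongrightarrow> 0"
    and U: "\<And>j. finite (U j)" "\<And>j. U j \<subseteq> sets M" "\<And>j. X = \<Union>(U j)"
      "\<And>j u x y. u \<in> U j \<Longrightarrow> x \<in> u \<Longrightarrow> y \<in> u \<Longrightarrow> dist x y \<le> 2 / real (Suc j)"
    and d: "\<And>j n. real (card (U j)) ^ (n div d j) \<le> exp (real n * (1 / 2) ^ (j + 2))"
    and F: "finite F" "F \<noteq> {}" "\<And>V. V \<in> F \<Longrightarrow> closed V \<and> V \<subseteq> X \<and> 0 < prob V"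
      "\<And>V W x. V \<in> F \<Longrightarrow> W \<in> F \<Longrightarrow> x \<in> V \<Longrightarrow> x \<in> W \<Longrightarrow> V = W"
  shows "\<exists>n>n0. \<exists>F'. finite F' \<and> (\<forall>W\<in>F'. closed W \<and> W \<subseteq> X \<and> 0 < prob W)
    \<and> (\<forall>W\<in>F'. \<exists>V\<in>F. W \<subseteq> V) \<and> (\<forall>V\<in>F. \<exists>W\<in>F'. W \<subseteq> V)
    \<and> exp (real n) \<le> real (card F')
    \<and> (\<forall>V\<in>F'. \<forall>W\<in>F'. V \<noteq> W \<longrightarrow> (\<forall>x\<in>V. \<forall>y\<in>W. \<forall>m\<le>k.
        \<exists>i < n div Suc m. eps m / 2 \<le> dist ((T ^^ i) x) ((T ^^ i) y)))
    \<and> (\<forall>V\<in>F. \<forall>W\<in>F'. \<forall>W'\<in>F'. W \<subseteq> V \<longrightarrow> W' \<subseteq> V \<longrightarrow> (\<forall>x\<in>W. \<forall>y\<in>W'. \<forall>j\<le>k.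
        \<forall>i < n div d j. dist ((T ^^ i) x) ((T ^^ i) y) \<le> 4 / real (Suc j)))"
proof -
  define bad where "bad m n = {x \<in> X. exp (- (3 * real (Suc m) * real n)) < prob (bowen_ball n x (eps m))}" for m n
  have bad_sets: "bad m n \<in> sets M" for m n
    unfolding bad_def by (rule large_bowen_ball_sets)
  define v where "v = Min (prob ` F)"
  have v: "0 < v" "\<And>V. V \<in> F \<Longrightarrow> v \<le> prob V"
    using F(1,2,3) by (auto simp: v_def)
  define \<beta> where "\<beta> n = real (Suc k) * exp (- (2 * real n))" for n :: nat
  define b where "b n = nat \<lceil>exp (real n)\<rceil>" for n :: nat
  have "\<forall>\<^sub>F n in sequentially. \<forall>m\<in>{..k}. prob (bad m (n div Suc m)) < v / (2 * real (Suc k))"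
  proof (intro eventually_ball_finite ballI)
    fix m
    have "filterlim (\<lambda>n. n div Suc m) at_top sequentially"
      unfolding filterlim_at_top
    proof
      fix Z :: nat
      show "\<forall>\<^sub>F n in sequentially. Z \<le> n div Suc m"
        using eventually_ge_at_top[of "Z * Suc m"]
        by eventually_elim (subst less_eq_div_iff_mult_less_eq, auto)
    qed
    then have "(\<lambda>n. prob (bad m (n div Suc m))) \<longlonglongrightarrow> 0"
      using filterlim_compose[OF small[of m]] unfolding bad_def by blast
    then show "\<forall>\<^sub>F n in sequentially. prob (bad m (n div Suc m)) < v / (2 * real (Suc k))"
      using v(1) by (intro order_tendstoD(2)) auto
  qed simp
  moreover have "\<forall>\<^sub>F n in sequentially. 4 * real (card F) * real (Suc k) < v * exp (real n / 2)"
    using v(1) by real_asymp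
  moreover have "\<forall>\<^sub>F n in sequentially. max n0 (3 * Suc k) < n"
    by (rule eventually_gt_at_top)
  ultimately have "\<forall>\<^sub>F n in sequentially. (\<forall>m\<in>{..k}. prob (bad m (n div Suc m)) < v / (2 * real (Suc k)))
      \<and> 4 * real (card F) * real (Suc k) < v * exp (real n / 2) \<and> max n0 (3 * Suc k) < n"
    by eventually_elim blast
  then obtain n where "(\<forall>m\<in>{..k}. prob (bad m (n div Suc m)) < v / (2 * real (Suc k)))
      \<and> 4 * real (card F) * real (Suc k) < v * exp (real n / 2) \<and> max n0 (3 * Suc k) < n"
    using eventually_happens'[OF sequentially_bot] by blast
  then have n_bad: "\<And>m. m \<le> k \<Longrightarrow> prob (bad m (n div Suc m)) < v / (2 * real (Suc k))"
    and n_big: "4 * real (card F) * real (Suc k) < v * exp (real n / 2)" "n0 < n" "3 * Suc k < n"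
    by auto
  define H where "H = X - (\<Union>m\<in>{..k}. bad m (n div Suc m))"
  have H_sets: "H \<in> sets M"
    unfolding H_def using bad_sets by (intro sets.Diff sets.finite_UN) auto
  have H_small: "prob (bowen_ball (n div Suc m) x (eps m)) \<le> exp (- (2 * real n))" if "x \<in> H" "m \<le> k" for x m
  proof -
    have "prob (bowen_ball (n div Suc m) x (eps m)) \<le> exp (- (3 * real (Suc m) * real (n div Suc m)))"
      using that by (force simp: H_def bad_def not_less)
    moreover have "2 * n \<le> 3 * (Suc m * (n div Suc m))"
    proof -
      have "2 * n \<le> 3 * c" if "c + s = n" "s \<le> m" for c s
        using that n_big(3) \<open>m \<le> k\<close> by arith
      then show ?thesis
        using mult_div_mod_eq[of "Suc m" n] mod_less_divisor[of "Suc m" n] by (meson less_Suc_eq_le zero_less_Suc)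
    qed
    then have "exp (- (3 * real (Suc m) * real (n div Suc m))) \<le> exp (- (2 * real n))"
      by (metis (no_types, lifting) exp_le_cancel_iff mult.assoc neg_le_iff_le of_nat_le_iff of_nat_mult of_nat_numeral)
    ultimately show ?thesis by (rule order_trans)
  qed
  \<comment> \<open>The admissible loss in distance when a selected point is replaced by a nearby one.\<close>
  obtain \<eta> where \<eta>: "0 < \<eta>" "\<And>m. m \<le> k \<Longrightarrow> \<eta> \<le> eps m / 4" "\<eta> \<le> 1 / real (Suc k)"
  proof -
    have "\<exists>\<eta>>0. \<forall>m\<in>{..k}. \<eta> \<le> eps m / 4"
    proof (rule ex_common_pos)
      show "\<exists>\<eta>>0. \<eta> \<le> eps m / 4" for m
        using eps[of m] by (intro exI[of _ "eps m / 4"]) auto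
    qed auto
    then obtain \<eta>' where "0 < \<eta>'" "\<And>m. m \<le> k \<Longrightarrow> \<eta>' \<le> eps m / 4" by auto
    then show thesis
      by (intro that[of "min \<eta>' (1 / real (Suc k))"]) (auto intro: min.coboundedI1 simp del: le_divide_eq_numeral1 of_nat_Suc)
  qed
  obtain r where r: "0 < r" "\<And>i x y. i < n \<Longrightarrow> x \<in> X \<Longrightarrow> y \<in> X \<Longrightarrow> dist x y \<le> r
      \<Longrightarrow> dist ((T ^^ i) x) ((T ^^ i) y) \<le> \<eta>"
    using T_pow_uniformly_continuous[OF \<eta>(1), of n] by blast
  obtain C where C: "finite C" "X \<subseteq> (\<Union>c\<in>C. ball c (r / 2))"
    using compact_X r(1) unfolding compact_eq_totally_bounded by (meson half_gt_zero)
  have "\<exists>W. W \<in> sets M \<and> W \<subseteq> V \<inter> H \<and> v / 2 * exp (- (real n / 2)) \<le> prob W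
      \<and> (\<forall>x\<in>W. 0 < prob (V \<inter> cball x r))
      \<and> (\<forall>x\<in>W. \<forall>y\<in>W. \<forall>j\<le>k. \<forall>i<n div d j. dist ((T ^^ i) x) ((T ^^ i) y) \<le> 2 / real (Suc j))"
    if V: "V \<in> F" for V
  proof -
    have V_sets: "V \<in> sets M" using F(3)[OF V] by (intro closed_sets) auto
    have "prob V \<le> prob ((V \<inter> H) \<union> (\<Union>m\<in>{..k}. bad m (n div Suc m)))"
      using V_sets H_sets bad_sets F(3)[OF V]
      by (intro finite_measure_mono sets.Un sets.Int sets.finite_UN) (auto simp: H_def)
    also have "\<dots> \<le> prob (V \<inter> H) + prob (\<Union>m\<in>{..k}. bad m (n div Suc m))"
      using V_sets H_sets bad_sets by (intro measure_Un_le sets.Int sets.finite_UN) auto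
    also have "prob (\<Union>m\<in>{..k}. bad m (n div Suc m)) \<le> (\<Sum>m\<in>{..k}. prob (bad m (n div Suc m)))"
      using bad_sets by (intro finite_measure_subadditive_finite) auto
    also have "\<dots> \<le> (\<Sum>m\<in>{..k}. v / (2 * real (Suc k)))"
      using n_bad by (intro sum_mono less_imp_le) auto
    also have "\<dots> = v / 2" by (simp add: field_simps)
    finally have VH: "v / 2 \<le> prob (V \<inter> H)" using v(2)[OF V] by linarith
    obtain W where W: "W \<in> sets M" "W \<subseteq> V \<inter> H"
      "prob (V \<inter> H) \<le> (\<Prod>j<Suc k. real (card (U j)) ^ (n div d j)) * prob W"
      "\<And>j i. j < Suc k \<Longrightarrow> i < n div d j \<Longrightarrow> \<exists>u\<in>U j. \<forall>x\<in>W. (T ^^ i) x \<in> u"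
      using pigeonhole_scales[where U = U and k = "Suc k" and n = "\<lambda>j. n div d j",
          OF sets.Int[OF V_sets H_sets] U(1,2,3)] by blast
    have "(\<Prod>j<Suc k. real (card (U j)) ^ (n div d j)) \<le> (\<Prod>j<Suc k. exp (real n * (1 / 2) ^ (j + 2)))"
      using d by (intro prod_mono) auto
    also have "\<dots> = exp (real n * (\<Sum>j<Suc k. (1 / 2) ^ (j + 2)))"
      by (simp only: sum_distrib_left exp_sum finite_lessThan)
    also have "(\<Sum>j<Suc k. (1 / 2 :: real) ^ (j + 2)) = 1 / 2 - (1 / 2) ^ (k + 2)"
      by (induction k) auto
    also have "exp (real n * (1 / 2 - (1 / 2) ^ (k + 2))) \<le> exp (real n / 2)"
      by (simp add: algebra_simps)
    finally have "v / 2 \<le> exp (real n / 2) * prob W"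
      using VH W(3) by (meson mult_right_mono measure_nonneg order_trans)
    then have prob_W: "v / 2 * exp (- (real n / 2)) \<le> prob W"
      by (simp add: exp_minus field_simps)
    \<comment> \<open>A finite net replaces the support of the measure: outside \<open>N\<close> every point has a nonnull neighbourhood in \<open>V\<close>.\<close>
    define N where "N = (\<Union>c\<in>{c \<in> C. prob (V \<inter> ball c (r / 2)) = 0}. V \<inter> ball c (r / 2))"
    have VC: "V \<inter> ball c (r / 2) \<in> sets M" for c
      using F(3)[OF V] borel_Int_sets[of "V \<inter> ball c (r / 2)"] by (simp add: Int_absorb2 le_infI1)
    have N_sets: "N \<in> sets M"
      unfolding N_def using C(1) VC by (intro sets.finite_UN) auto
    have "prob N \<le> (\<Sum>c\<in>{c \<in> C. prob (V \<inter> ball c (r / 2)) = 0}. prob (V \<inter> ball c (r / 2)))"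
      unfolding N_def using C(1) VC by (intro finite_measure_subadditive_finite) auto
    also have "\<dots> = 0" by (intro sum.neutral) auto
    finally have "prob N = 0" by (simp add: measure_le_0_iff)
    then have "prob (W - N) = prob W"
      using W(1) N_sets by (intro measure_Diff_null_set) (auto simp: null_sets_def emeasure_eq_measure)
    moreover have "0 < prob (V \<inter> cball x r)" if x: "x \<in> W - N" for x
    proof -
      have "x \<in> V" "x \<in> X" using x W(2) F(3)[OF V] by auto
      then obtain c where c: "c \<in> C" "x \<in> ball c (r / 2)" using C(2) by blast
      have "prob (V \<inter> ball c (r / 2)) \<noteq> 0"
        using x c \<open>x \<in> V\<close> by (auto simp: N_def)
      then have "0 < prob (V \<inter> ball c (r / 2))" by (simp add: zero_less_measure_iff)
      also have "\<dots> \<le> prob (V \<inter> cball x r)"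
      proof (rule finite_measure_mono)
        show "V \<inter> cball x r \<in> sets M" using F(3)[OF V] by (intro closed_sets) auto
        have "dist x y \<le> r" if "dist c y < r / 2" for y
          using that c(2) dist_triangle3[of x y c] by simp
        then show "V \<inter> ball c (r / 2) \<subseteq> V \<inter> cball x r" by auto
      qed
      finally show ?thesis .
    qed
    moreover have "dist ((T ^^ i) x) ((T ^^ i) y) \<le> 2 / real (Suc j)"
      if "x \<in> W - N" "y \<in> W - N" "j \<le> k" "i < n div d j" for x y j i
      using that W(4)[of j i] U(4) by (metis DiffD1 le_imp_less_Suc)
    ultimately show ?thesis
      using W(1,2) N_sets prob_W by (intro exI[of _ "W - N"]) auto
  qed
  then have "\<forall>V\<in>F. \<exists>W. W \<in> sets M \<and> W \<subseteq> V \<inter> H \<and> v / 2 * exp (- (real n / 2)) \<le> prob W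
      \<and> (\<forall>x\<in>W. 0 < prob (V \<inter> cball x r))
      \<and> (\<forall>x\<in>W. \<forall>y\<in>W. \<forall>j\<le>k. \<forall>i<n div d j. dist ((T ^^ i) x) ((T ^^ i) y) \<le> 2 / real (Suc j))"
    by (rule ballI)
  from bchoice[OF this] obtain W where W0: "\<forall>V\<in>F. W V \<in> sets M \<and> W V \<subseteq> V \<inter> H \<and> v / 2 * exp (- (real n / 2)) \<le> prob (W V)
      \<and> (\<forall>x\<in>W V. 0 < prob (V \<inter> cball x r))
      \<and> (\<forall>x\<in>W V. \<forall>y\<in>W V. \<forall>j\<le>k. \<forall>i<n div d j. dist ((T ^^ i) x) ((T ^^ i) y) \<le> 2 / real (Suc j))"
    by (elim exE)
  have W: "\<And>V. V \<in> F \<Longrightarrow> W V \<in> sets M" "\<And>V. V \<in> F \<Longrightarrow> W V \<subseteq> V \<inter> H"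
    "\<And>V. V \<in> F \<Longrightarrow> v / 2 * exp (- (real n / 2)) \<le> prob (W V)"
    "\<And>V x. V \<in> F \<Longrightarrow> x \<in> W V \<Longrightarrow> 0 < prob (V \<inter> cball x r)"
    "\<And>V x y j i. V \<in> F \<Longrightarrow> x \<in> W V \<Longrightarrow> y \<in> W V \<Longrightarrow> j \<le> k \<Longrightarrow> i < n div d j
      \<Longrightarrow> dist ((T ^^ i) x) ((T ^^ i) y) \<le> 2 / real (Suc j)"
    using W0 by blast+
  \<comment> \<open>The points that some scale \<open>eps m\<close> with \<open>m \<le> k\<close> does not separate from \<open>x\<close>.\<close>
  define B where "B x = (\<Union>m\<in>{..k}. bowen_ball (n div Suc m) x (eps m))" for x
  define I where "I = F \<times> {..<b n}"
  have b_n: "exp (real n) \<le> real (b n)" "real (b n) \<le> 2 * exp (real n)"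
  proof -
    show "exp (real n) \<le> real (b n)" unfolding b_def by (rule real_nat_ceiling_ge)
    have "real (b n) \<le> exp (real n) + 1" by (simp add: b_def)
    also have "\<dots> \<le> 2 * exp (real n)" using one_le_exp_iff[of "real n"] by simp
    finally show "real (b n) \<le> 2 * exp (real n)" .
  qed
  have card_I: "real (card I) \<le> real (card F) * (2 * exp (real n))"
    using b_n(2) by (simp add: I_def card_cartesian_product mult_left_mono)
  have "\<exists>p. (\<forall>i\<in>I. p i \<in> W (fst i)) \<and> (\<forall>i\<in>I. \<forall>j\<in>I. i \<noteq> j \<longrightarrow> p i \<notin> B (p j))"
  proof (rule ex_separated_points[OF _ card_I])
    show "finite I" using F(1) by (simp add: I_def)
    show "0 \<le> \<beta> n" by (simp add: \<beta>_def)
    show "B x \<in> sets M" for x unfolding B_def by (intro sets.finite_UN) auto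
    show "x \<in> B y" if "x \<in> X" "y \<in> B x" for x y
      using that(2) bowen_ball_commute[OF that(1)] unfolding B_def by blast
    fix i assume i: "i \<in> I"
    then have V: "fst i \<in> F" by (auto simp: I_def)
    then show "W (fst i) \<in> sets M" by (rule W(1))
    show "prob (B x) \<le> \<beta> n" if "x \<in> W (fst i)" for x
    proof -
      have "x \<in> H" using that W(2)[OF V] by blast
      have "prob (B x) \<le> (\<Sum>m\<in>{..k}. prob (bowen_ball (n div Suc m) x (eps m)))"
        unfolding B_def by (intro finite_measure_subadditive_finite) auto
      also have "\<dots> \<le> (\<Sum>m\<in>{..k}. exp (- (2 * real n)))"
        using H_small[OF \<open>x \<in> H\<close>] by (intro sum_mono) auto
      also have "\<dots> = \<beta> n" by (simp add: \<beta>_def)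
      finally show ?thesis .
    qed
    have e: "exp (real n) * exp (- (2 * real n)) = exp (- (real n / 2)) * exp (- (real n / 2))"
      by (simp flip: exp_add)
    have "real (card F) * (2 * exp (real n)) * \<beta> n
        = 4 * real (card F) * real (Suc k) * (exp (real n) * exp (- (2 * real n))) / 2"
      by (simp add: \<beta>_def)
    also have "\<dots> = 4 * real (card F) * real (Suc k) * (exp (- (real n / 2)) * exp (- (real n / 2))) / 2"
      unfolding e ..
    also have "\<dots> < v * exp (real n / 2) * (exp (- (real n / 2)) * exp (- (real n / 2))) / 2"
      using n_big(1) by (intro divide_strict_right_mono mult_strict_right_mono) auto
    also have "\<dots> = v / 2 * exp (- (real n / 2))" by (simp add: exp_minus field_simps)
    also have "\<dots> \<le> prob (W (fst i))" by (rule W(3)[OF V])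
    finally show "real (card F) * (2 * exp (real n)) * \<beta> n < prob (W (fst i))" .
  qed
  then obtain p where p_W: "\<forall>i\<in>I. p i \<in> W (fst i)"
    and p_B: "\<forall>i\<in>I. \<forall>j\<in>I. i \<noteq> j \<longrightarrow> p i \<notin> B (p j)"
    by (elim exE conjE)
  note p = p_W[rule_format] p_B[rule_format]
  have I_F: "fst i \<in> F" if "i \<in> I" for i using that by (auto simp: I_def)
  have p_X: "p i \<in> X" if "i \<in> I" for i
    using p(1)[OF that] W(2)[OF I_F[OF that]] F(3)[OF I_F[OF that]] by blast
  define ch where "ch i = fst i \<inter> cball (p i) r" for i
  have ch_X: "ch i \<subseteq> X" if "i \<in> I" for i
    using F(3)[OF I_F[OF that]] by (auto simp: ch_def)
  have near: "dist ((T ^^ t) (p i)) ((T ^^ t) x) \<le> \<eta>" if "i \<in> I" "x \<in> ch i" "t < n" for i x t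
    using that ch_X[OF that(1)] p_X[OF that(1)] by (intro r(2)) (auto simp: ch_def)
  have ch_prob: "0 < prob (ch i)" if "i \<in> I" for i
    unfolding ch_def by (rule W(4)[OF I_F[OF that] p(1)[OF that]])
  have sep: "\<exists>t < n div Suc m. eps m / 2 \<le> dist ((T ^^ t) x) ((T ^^ t) y)"
    if ij: "i \<in> I" "j \<in> I" "i \<noteq> j" and xy: "x \<in> ch i" "y \<in> ch j" and m: "m \<le> k" for i j x y m
  proof -
    have "p j \<notin> bowen_ball (n div Suc m) (p i) (eps m)"
      using p(2)[OF ij(2,1)] ij(3) m by (auto simp: B_def)
    then obtain t where t: "t < n div Suc m" "eps m \<le> dist ((T ^^ t) (p i)) ((T ^^ t) (p j))"
      using p_X[OF ij(2)] by (auto simp: bowen_ball_def not_less)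
    have "t < n" using t(1) div_le_dividend[of n "Suc m"] by linarith
    then have "dist ((T ^^ t) (p i)) ((T ^^ t) x) \<le> eps m / 4" "dist ((T ^^ t) (p j)) ((T ^^ t) y) \<le> eps m / 4"
      using near ij xy \<eta>(2)[OF m] by (meson order_trans)+
    then have "eps m / 2 \<le> dist ((T ^^ t) x) ((T ^^ t) y)"
      using t(2) dist_triangle[of "(T ^^ t) (p i)" "(T ^^ t) (p j)" "(T ^^ t) x"]
        dist_triangle[of "(T ^^ t) x" "(T ^^ t) (p j)" "(T ^^ t) y"]
      by (simp add: dist_commute)
    with t(1) show ?thesis by blast
  qed
  have ch_ne: "ch i \<noteq> {}" if "i \<in> I" for i using ch_prob[OF that] by auto
  have inj: "inj_on ch I"
  proof (rule inj_onI, rule ccontr)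
    fix i j assume ij: "i \<in> I" "j \<in> I" "ch i = ch j" "i \<noteq> j"
    obtain x where x: "x \<in> ch i" using ch_ne[OF ij(1)] by blast
    then show False using sep[OF ij(1,2,4) x, of x 0] ij(3) eps[of 0] by fastforce
  qed
  \<comment> \<open>A new set lies in only one member of the old family, namely the one in which its centre was selected.\<close>
  have parent_eq: "fst i = V" if i: "i \<in> I" "V \<in> F" "ch i \<subseteq> V" for i V
  proof -
    obtain x where "x \<in> ch i" using ch_ne[OF i(1)] by blast
    then show ?thesis using F(4)[OF I_F[OF i(1)] i(2), of x] i(3) by (auto simp: ch_def)
  qed
  define F' where "F' = ch ` I"
  have "finite F'" using F(1) by (simp add: F'_def I_def)
  moreover have "\<forall>W\<in>F'. closed W \<and> W \<subseteq> X \<and> 0 < prob W"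
    using F(3) I_F ch_X ch_prob by (auto simp: F'_def ch_def intro!: closed_Int)
  moreover have "\<forall>W\<in>F'. \<exists>V\<in>F. W \<subseteq> V"
    using I_F by (auto simp: F'_def ch_def)
  moreover have "\<forall>V\<in>F. \<exists>W\<in>F'. W \<subseteq> V"
  proof
    fix V assume "V \<in> F"
    moreover have "0 < b n" using b_n(1) exp_gt_zero[of "real n"] by (metis of_nat_0_less_iff less_le_trans)
    ultimately have "(V, 0) \<in> I" by (simp add: I_def)
    then show "\<exists>W\<in>F'. W \<subseteq> V" by (auto simp: F'_def ch_def intro!: bexI[of _ "(V, 0)"])
  qed
  moreover have "exp (real n) \<le> real (card F')"
  proof -
    have "1 \<le> card F" using F(1,2) by (simp add: Suc_le_eq card_gt_0_iff)
    then have "b n \<le> card I" by (simp add: I_def card_cartesian_product)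
    then show ?thesis using b_n(1) card_image[OF inj] by (simp add: F'_def)
  qed
  moreover have "\<forall>V\<in>F'. \<forall>W\<in>F'. V \<noteq> W \<longrightarrow> (\<forall>x\<in>V. \<forall>y\<in>W. \<forall>m\<le>k.
        \<exists>i < n div Suc m. eps m / 2 \<le> dist ((T ^^ i) x) ((T ^^ i) y))"
    using sep unfolding F'_def by blast
  moreover have "dist ((T ^^ t) x) ((T ^^ t) y) \<le> 4 / real (Suc m)"
    if V: "V \<in> F" and ij: "i \<in> I" "j \<in> I" "ch i \<subseteq> V" "ch j \<subseteq> V" "x \<in> ch i" "y \<in> ch j"
      and m: "m \<le> k" "t < n div d m" for V i j x y m t
  proof -
    have "fst i = V" "fst j = V" using parent_eq V ij by auto
    then have "dist ((T ^^ t) (p i)) ((T ^^ t) (p j)) \<le> 2 / real (Suc m)"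
      using p(1)[OF ij(1)] p(1)[OF ij(2)] by (intro W(5)[OF V _ _ m]) auto
    moreover have "t < n" using m(2) div_le_dividend[of n "d m"] by linarith
    then have "dist ((T ^^ t) (p i)) ((T ^^ t) x) \<le> \<eta>" "dist ((T ^^ t) (p j)) ((T ^^ t) y) \<le> \<eta>"
      using near ij by blast+
    moreover have "\<eta> \<le> 1 / real (Suc m)"
      using m(1) by (intro order_trans[OF \<eta>(3)] frac_le) auto
    moreover have "4 / real (Suc m) = 2 / real (Suc m) + 1 / real (Suc m) + 1 / real (Suc m)"
      by (simp add: add_divide_distrib[symmetric])
    ultimately show ?thesis
      using dist_triangle[of "(T ^^ t) x" "(T ^^ t) y" "(T ^^ t) (p i)"]
        dist_triangle[of "(T ^^ t) (p i)" "(T ^^ t) y" "(T ^^ t) (p j)"]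
      by (simp add: dist_commute)
  qed
  then have "\<forall>V\<in>F. \<forall>W\<in>F'. \<forall>W'\<in>F'. W \<subseteq> V \<longrightarrow> W' \<subseteq> V \<longrightarrow> (\<forall>x\<in>W. \<forall>y\<in>W'. \<forall>j\<le>k.
        \<forall>i < n div d j. dist ((T ^^ i) x) ((T ^^ i) y) \<le> 4 / real (Suc j))"
    unfolding F'_def by blast
  ultimately show ?thesis using n_big(2) by blast
qed

end

section \<open>Entropy of the sets carried by a separated tree\<close>

lemma cover_number_le:
  assumes "F \<subseteq> C" "finite F" "L \<subseteq> \<Union>F"
  shows "cover_number C L \<le> card F"
  unfolding cover_number_def by (rule Least_le) (use assms in blast)

lemma le_cover_number:
  assumes "finite C" "L \<subseteq> \<Union>C" and ge: "\<And>F. F \<subseteq> C \<Longrightarrow> finite F \<Longrightarrow> L \<subseteq> \<Union>F \<Longrightarrow> m \<le> card F"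
  shows "m \<le> cover_number C L"
proof -
  have "\<exists>k. \<exists>F\<subseteq>C. finite F \<and> card F = k \<and> L \<subseteq> \<Union>F" using assms(1,2) by blast
  then have "\<exists>F\<subseteq>C. finite F \<and> card F = cover_number C L \<and> L \<subseteq> \<Union>F"
    unfolding cover_number_def by (rule LeastI_ex)
  then show ?thesis using ge by metis
qed

lemma Union_iterated_join:
  assumes "\<And>x. x \<in> X \<Longrightarrow> T x \<in> X" "\<Union>U = X"
  shows "X \<subseteq> \<Union>(iterated_join X T U n)"
proof
  fix x assume x: "x \<in> X"
  have "(T ^^ i) x \<in> X" for i by (induction i) (auto simp: x assms(1))
  then have "\<exists>f. \<forall>i. f i \<in> U \<and> (T ^^ i) x \<in> f i"
    by (intro choice) (use assms(2) in blast)
  then obtain f where f: "\<And>i. f i \<in> U \<and> (T ^^ i) x \<in> f i" by blast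
  have "x \<in> {x \<in> X. \<forall>i<n. (T ^^ i) x \<in> f i}" using x f by simp
  moreover have "{x \<in> X. \<forall>i<n. (T ^^ i) x \<in> f i} \<in> iterated_join X T U n"
    unfolding iterated_join_def using f by blast
  ultimately show "x \<in> \<Union>(iterated_join X T U n)" by blast
qed

text \<open>
  The measure has done its work once the tree exists: the entropies of the subsets of its limit set
  depend only on the following metric conditions. The scale \<open>eps m\<close> separates the nodes of level \<open>k\<close> from
  \<open>k = m + 1\<close> on, and from level \<open>j\<close> on the resolution \<open>4 / Suc j\<close> does not show before
  \<open>time (Suc k) div d j\<close> that a node of level \<open>k\<close> has several children.
\<close>

locale separated_tree =
  fixes X :: "'a::metric_space set" and T :: "'a \<Rightarrow> 'a"
    and eps :: "nat \<Rightarrow> real" and d :: "nat \<Rightarrow> nat"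
    and time :: "nat \<Rightarrow> nat" and tree :: "nat \<Rightarrow> 'a set set"
  assumes compact_X: "compact X"
    and T_in: "\<And>x. x \<in> X \<Longrightarrow> T x \<in> X"
    and eps_pos: "\<And>m. 0 < eps m"
    and d_pos: "\<And>j. 0 < d j"
    and time_mono: "strict_mono time"
    and tree_0: "tree 0 = {X}"
    and finite_tree: "\<And>k. finite (tree k)"
    and tree_closed: "\<And>k V. V \<in> tree k \<Longrightarrow> closed V"
    and tree_nonempty: "\<And>k V. V \<in> tree k \<Longrightarrow> V \<noteq> {}"
    and parent: "\<And>k W. W \<in> tree (Suc k) \<Longrightarrow> \<exists>V\<in>tree k. W \<subseteq> V"
    and child: "\<And>k V. V \<in> tree k \<Longrightarrow> \<exists>W\<in>tree (Suc k). W \<subseteq> V"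
    and many: "\<And>k. exp (real (time (Suc k))) \<le> real (card (tree (Suc k)))"
    and separated: "\<And>k V W x y m. V \<in> tree k \<Longrightarrow> W \<in> tree k \<Longrightarrow> V \<noteq> W \<Longrightarrow> x \<in> V \<Longrightarrow> y \<in> W \<Longrightarrow> m < k
        \<Longrightarrow> \<exists>i < time k div Suc m. eps m / 2 \<le> dist ((T ^^ i) x) ((T ^^ i) y)"
    and clustered: "\<And>k V W W' x y j i. V \<in> tree k \<Longrightarrow> W \<in> tree (Suc k) \<Longrightarrow> W' \<in> tree (Suc k) \<Longrightarrow> W \<subseteq> V \<Longrightarrow> W' \<subseteq> V
        \<Longrightarrow> x \<in> W \<Longrightarrow> y \<in> W' \<Longrightarrow> j \<le> k \<Longrightarrow> i < time (Suc k) div d j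
        \<Longrightarrow> dist ((T ^^ i) x) ((T ^^ i) y) \<le> 4 / real (Suc j)"
begin

lemma disjoint_tree:
  assumes "V \<in> tree k" "W \<in> tree k" "x \<in> V" "x \<in> W"
  shows "V = W"
proof (cases "k = 0")
  case False
  then show ?thesis using separated[OF assms(1,2) _ assms(3,4), of 0] eps_pos[of 0] by fastforce
qed (use assms tree_0 in auto)

definition limit_set :: "'a set" where
  "limit_set = (\<Inter>k. \<Union>(tree k))"

lemma limit_set_subset: "limit_set \<subseteq> X"
  using tree_0 by (auto simp: limit_set_def)

lemma closed_Union_tree: "closed (\<Union>(tree k))"
  using finite_tree tree_closed by (intro closed_Union) auto

lemma Union_tree_mono: "k \<le> l \<Longrightarrow> \<Union>(tree l) \<subseteq> \<Union>(tree k)"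
proof (induction rule: dec_induct)
  case (step l)
  then show ?case using parent by blast
qed simp

lemma compact_limit_set: "compact limit_set"
proof -
  have "closed limit_set"
    unfolding limit_set_def using closed_Union_tree by blast
  then show ?thesis
    using compact_Int_closed[OF compact_X] limit_set_subset by (metis Int_absorb1)
qed

lemma descendant: "k \<le> l \<Longrightarrow> V \<in> tree k \<Longrightarrow> \<exists>W\<in>tree l. W \<subseteq> V"
proof (induction l rule: dec_induct)
  case (step l)
  then show ?case using child by (meson subset_trans)
qed auto

lemma tree_subset: "V \<in> tree k \<Longrightarrow> V \<subseteq> X"
  using Union_tree_mono[of 0 k] tree_0 by auto

lemma tree_meets_limit_set:
  assumes V: "V \<in> tree k"
  shows "V \<inter> limit_set \<noteq> {}"
proof -
  have "compact V"
    using compact_Int_closed[OF compact_X tree_closed[OF V]] tree_subset[OF V] by (simp add: Int_absorb1)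
  then have "V \<inter> (\<Inter>l\<in>UNIV. \<Union>(tree l)) \<noteq> {}"
  proof (rule compact_imp_fip_image)
    fix I :: "nat set" assume I: "finite I"
    define l where "l = Max (insert k I)"
    obtain W where W: "W \<in> tree l" "W \<subseteq> V"
      using descendant[of k l, OF _ V] I by (auto simp: l_def)
    have "W \<subseteq> \<Union>(tree i)" if "i \<in> I" for i
    proof -
      have "i \<le> l" unfolding l_def using I that by (intro Max_ge) auto
      then show ?thesis using Union_tree_mono[of i l] W by blast
    qed
    then show "V \<inter> (\<Inter>i\<in>I. \<Union>(tree i)) \<noteq> {}"
      using W tree_nonempty[OF W(1)] by blast
  qed (rule closed_Union_tree)
  then show ?thesis by (simp add: limit_set_def)
qed

definition nodes :: "nat \<Rightarrow> 'a set \<Rightarrow> 'a set set" where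
  "nodes k L = {V \<in> tree k. V \<inter> L \<noteq> {}}"

lemma finite_nodes: "finite (nodes k L)"
  using finite_tree by (simp add: nodes_def)

lemma nodes_limit_set: "nodes k limit_set = tree k"
  using tree_meets_limit_set by (auto simp: nodes_def)

lemma nodes_nonempty: "L \<subseteq> limit_set \<Longrightarrow> L \<noteq> {} \<Longrightarrow> 1 \<le> card (nodes k L)"
  using finite_nodes[of k L] by (auto simp: Suc_le_eq card_gt_0_iff nodes_def limit_set_def)

text \<open>
  Nodes of one level are disjoint, so the points of the limit set in \<open>V\<close> lie in children of \<open>V\<close>, to which
  \<open>clustered\<close> applies.
\<close>

lemma node_orbits_close:
  assumes "V \<in> tree k" "x \<in> V \<inter> limit_set" "y \<in> V \<inter> limit_set" "j \<le> k" "i < time (Suc k) div d j"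
  shows "dist ((T ^^ i) x) ((T ^^ i) y) \<le> 4 / real (Suc j)"
proof -
  have "\<exists>W\<in>tree (Suc k). W \<subseteq> V \<and> z \<in> W" if z: "z \<in> V \<inter> limit_set" for z
  proof -
    obtain W where W: "W \<in> tree (Suc k)" "z \<in> W" using z by (auto simp: limit_set_def)
    obtain V' where V': "V' \<in> tree k" "W \<subseteq> V'" using parent[OF W(1)] by blast
    have "V' = V" using V' W z disjoint_tree[OF V'(1) assms(1), of z] by blast
    then show ?thesis using W V' by blast
  qed
  then show ?thesis using assms clustered by meson
qed

lemma le_time: "k \<le> time k"
  using strict_mono_imp_increasing[OF time_mono] .

text \<open>
  With \<open>4 / Suc j\<close> below the Lebesgue number of the cover, the orbits in one node visit a common member
  of the cover at each time before \<open>time (Suc k) div d j\<close>, so that one member of the join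
  contains all points of the limit set in the node.
\<close>

lemma cover_number_le_nodes:
  assumes U: "finite_open_cover X U"
  shows "\<exists>j. \<forall>k\<ge>j. \<forall>n \<le> time (Suc k) div d j. \<forall>L\<subseteq>limit_set.
      cover_number (iterated_join X T U n) L \<le> card (nodes k L)"
proof -
  have "\<forall>A\<in>U. \<exists>O'. open O' \<and> A = X \<inter> O'"
    using U by (simp add: finite_open_cover_def openin_open)
  then obtain O' where O': "\<And>A. A \<in> U \<Longrightarrow> open (O' A)" "\<And>A. A \<in> U \<Longrightarrow> A = X \<inter> O' A"
    by (metis (no_types))
  have "X \<subseteq> \<Union>(O' ` U)" using U O'(2) by (fastforce simp: finite_open_cover_def)
  then obtain r where r: "0 < r" "\<And>x. x \<in> X \<Longrightarrow> \<exists>G\<in>O' ` U. ball x r \<subseteq> G"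
    using Heine_Borel_lemma[OF compact_X, of "O' ` U"] O'(1) by blast
  obtain j :: nat where j: "4 / r < real j" using reals_Archimedean2 by blast
  have small: "4 / real (Suc j) < r"
    using j r(1) by (simp add: field_simps)
  have "cover_number (iterated_join X T U n) L \<le> card (nodes k L)"
    if k: "j \<le> k" and n: "n \<le> time (Suc k) div d j" and L: "L \<subseteq> limit_set" for k n L
  proof -
    have "\<exists>A\<in>iterated_join X T U n. V \<inter> limit_set \<subseteq> A" if V: "V \<in> tree k" for V
    proof -
      obtain x where x: "x \<in> V \<inter> limit_set" using tree_meets_limit_set[OF V] by blast
      have orbit: "(T ^^ i) y \<in> X" if "y \<in> V \<inter> limit_set" for y i
        using that limit_set_subset T_in by (induction i) auto
      have "\<exists>A. A \<in> U \<and> ball ((T ^^ i) x) r \<subseteq> O' A" for i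
        using r(2)[OF orbit[OF x, of i]] by blast
      then obtain f where f: "\<And>i. f i \<in> U \<and> ball ((T ^^ i) x) r \<subseteq> O' (f i)" by metis
      have "(T ^^ i) y \<in> f i" if y: "y \<in> V \<inter> limit_set" and i: "i < n" for y i
      proof -
        have "dist ((T ^^ i) x) ((T ^^ i) y) \<le> 4 / real (Suc j)"
          using i n by (intro node_orbits_close[OF V x y k]) simp
        then have "(T ^^ i) y \<in> ball ((T ^^ i) x) r" using small by simp
        then have "(T ^^ i) y \<in> X \<inter> O' (f i)" using f orbit[OF y] by blast
        then show ?thesis using O'(2) f by blast
      qed
      then have "V \<inter> limit_set \<subseteq> {y \<in> X. \<forall>i<n. (T ^^ i) y \<in> f i}"
        using limit_set_subset by blast
      moreover have "{y \<in> X. \<forall>i<n. (T ^^ i) y \<in> f i} \<in> iterated_join X T U n"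
        unfolding iterated_join_def using f by blast
      ultimately show ?thesis by blast
    qed
    then obtain A where A: "\<And>V. V \<in> tree k \<Longrightarrow> A V \<in> iterated_join X T U n"
      "\<And>V. V \<in> tree k \<Longrightarrow> V \<inter> limit_set \<subseteq> A V" by metis
    have "L \<subseteq> \<Union>(A ` nodes k L)"
    proof
      fix x assume x: "x \<in> L"
      then have "x \<in> \<Union>(tree k)" using L by (auto simp: limit_set_def)
      then obtain V where "V \<in> tree k" "x \<in> V" by blast
      then show "x \<in> \<Union>(A ` nodes k L)" using x L A(2) by (auto simp: nodes_def)
    qed
    moreover have "A ` nodes k L \<subseteq> iterated_join X T U n"
      using A(1) by (auto simp: nodes_def)
    ultimately have "cover_number (iterated_join X T U n) L \<le> card (A ` nodes k L)"
      using finite_nodes by (intro cover_number_le) auto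
    also have "\<dots> \<le> card (nodes k L)" by (rule card_image_le[OF finite_nodes])
    finally show ?thesis .
  qed
  then show ?thesis by blast
qed

text \<open>
  A cover by balls of radius \<open>eps m / 4\<close> has members too small to contain two points at distance
  \<open>eps m / 2\<close>; hence a member of its join meets at most one node.
\<close>

lemma nodes_le_cover_number:
  "\<exists>U. finite_open_cover X U \<and> (\<forall>k>m. \<forall>L\<subseteq>limit_set.
      card (nodes k L) \<le> cover_number (iterated_join X T U (time k div Suc m)) L)"
proof -
  have e: "0 < eps m / 4" using eps_pos[of m] by simp
  then obtain C where C: "finite C" "X \<subseteq> (\<Union>c\<in>C. ball c (eps m / 4))"
    using compact_X unfolding compact_eq_totally_bounded by blast
  define U where "U = (\<lambda>c. X \<inter> ball c (eps m / 4)) ` C"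
  have U: "finite_open_cover X U"
    using C unfolding finite_open_cover_def U_def by (auto intro: openin_open_Int)
  have U_small: "dist x y < eps m / 2" if "A \<in> U" "x \<in> A" "y \<in> A" for A x y
  proof -
    obtain c where "dist c x < eps m / 4" "dist c y < eps m / 4" using \<open>A \<in> U\<close> \<open>x \<in> A\<close> \<open>y \<in> A\<close>
      by (auto simp: U_def)
    then show ?thesis using dist_triangle3[of x y c] by linarith
  qed
  have "card (nodes k L) \<le> cover_number (iterated_join X T U n) L"
    if k: "m < k" and L: "L \<subseteq> limit_set" and n: "n = time k div Suc m" for k L n
  proof (rule le_cover_number)
    show "finite (iterated_join X T U n)"
      unfolding iterated_join_eq_words using U by (simp add: finite_open_cover_def)
    have "X \<subseteq> \<Union>(iterated_join X T U n)"
      using U T_in by (intro Union_iterated_join) (auto simp: finite_open_cover_def)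
    then show "L \<subseteq> \<Union>(iterated_join X T U n)" using L limit_set_subset by blast
  next
    fix F assume F: "F \<subseteq> iterated_join X T U n" "finite F" "L \<subseteq> \<Union>F"
    have "\<forall>V\<in>nodes k L. \<exists>A\<in>F. V \<inter> A \<noteq> {}"
      using F(3) by (fastforce simp: nodes_def)
    then obtain A where A: "\<And>V. V \<in> nodes k L \<Longrightarrow> A V \<in> F" "\<And>V. V \<in> nodes k L \<Longrightarrow> V \<inter> A V \<noteq> {}"
      by metis
    have "inj_on A (nodes k L)"
    proof (rule inj_onI, rule ccontr)
      fix V W assume VW: "V \<in> nodes k L" "W \<in> nodes k L" "A V = A W" "V \<noteq> W"
      obtain x y where xy: "x \<in> V" "x \<in> A V" "y \<in> W" "y \<in> A V"
        using A(2)[OF VW(1)] A(2)[OF VW(2)] VW(3) by blast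
      have "A V \<in> iterated_join X T U n" using A(1)[OF VW(1)] F(1) by blast
      then obtain f where f: "A V = {x \<in> X. \<forall>i<n. (T ^^ i) x \<in> f i}" "\<forall>i<n. f i \<in> U"
        unfolding iterated_join_def by blast
      obtain i where i: "i < n" "eps m / 2 \<le> dist ((T ^^ i) x) ((T ^^ i) y)"
        using separated[of V k W x y m] VW xy k n by (auto simp: nodes_def)
      have "(T ^^ i) x \<in> f i" "(T ^^ i) y \<in> f i" "f i \<in> U"
        using xy f i(1) by auto
      with U_small[of "f i"] i(2) show False by fastforce
    qed
    then show "card (nodes k L) \<le> card F"
      using A(1) F(2) by (intro card_inj_on_le[of A]) auto
  qed
  with U show ?thesis by blast
qed

text \<open>
  A given \<open>n\<close> lies between \<open>time k div d j\<close> and \<open>time (Suc k) div d j\<close> for some \<open>k\<close>. On this range the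
  covering number is at most the number of nodes of level \<open>k\<close>, which is subexponential in \<open>time k\<close>, and
  \<open>time k\<close> is less than \<open>d j\<close> times \<open>n\<close>.
\<close>

lemma entropy_eq_0:
  assumes L: "L \<subseteq> limit_set" "L \<noteq> {}"
    and lim: "(\<lambda>k. ln (real (card (nodes k L))) / real (time k)) \<longlonglongrightarrow> 0"
  shows "topological_entropy X T L = 0"
proof -
  have "cover_entropy X T U L = 0" if U: "finite_open_cover X U" for U
  proof -
    obtain j where j: "\<And>k n. j \<le> k \<Longrightarrow> n \<le> time (Suc k) div d j
        \<Longrightarrow> cover_number (iterated_join X T U n) L \<le> card (nodes k L)"
      using cover_number_le_nodes[OF U] L(1) by blast
    define N where "N n = real (cover_number (iterated_join X T U n) L)" for n
    have ln_nonneg: "0 \<le> ln (N n)" for n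
      unfolding N_def by (cases "cover_number (iterated_join X T U n) L = 0") (auto simp: Suc_le_eq)
    have "(\<lambda>n. ln (N n) / real n) \<longlonglongrightarrow> 0"
    proof (rule LIMSEQ_I)
      fix e :: real assume e: "0 < e"
      have "\<forall>\<^sub>F k in sequentially. ln (real (card (nodes k L))) / real (time k) < e / real (d j)"
        using e d_pos[of j] by (intro order_tendstoD(2)[OF lim]) auto
      then obtain k0 where k0: "\<And>k. k0 \<le> k \<Longrightarrow> ln (real (card (nodes k L))) / real (time k) < e / real (d j)"
        by (auto simp: eventually_sequentially)
      define k1 where "k1 = max (max k0 j) 1"
      have "norm (ln (N n) / real n - 0) < e" if n: "Suc (time k1) \<le> n" for n
      proof -
        have ex: "\<exists>k. n \<le> time (Suc k) div d j"
        proof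
          have "n * d j \<le> time (Suc (n * d j))"
            using le_time[of "Suc (n * d j)"] by simp
          then show "n \<le> time (Suc (n * d j)) div d j"
            using d_pos[of j] by (simp add: less_eq_div_iff_mult_less_eq)
        qed
        define k where "k = (LEAST k. n \<le> time (Suc k) div d j)"
        have k: "n \<le> time (Suc k) div d j"
          unfolding k_def by (rule LeastI_ex[OF ex])
        have "time k1 < time (Suc k)"
          using k n div_le_dividend[of "time (Suc k)" "d j"] by linarith
        then have k1: "k1 \<le> k" using time_mono by (simp add: strict_mono_less)
        then obtain k' where k': "k = Suc k'" by (cases k) (auto simp: k1_def)
        have "\<not> n \<le> time (Suc k') div d j"
          using not_less_Least[of k' "\<lambda>k. n \<le> time (Suc k) div d j"] k' unfolding k_def by simp
        then have "time k div d j < n" using k' by simp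
        then have "time k < n * d j" using d_pos[of j] by (simp add: div_less_iff_less_mult)
        then have time_k: "real (time k) \<le> real n * real (d j)"
          by (metis less_imp_le of_nat_le_iff of_nat_mult)
        have pos: "0 < real (time k)" "0 < real n" "0 < real (d j)"
          using le_time[of k] k1 n d_pos[of j] by (auto simp: k1_def)
        have "1 \<le> card (nodes k L)" by (rule nodes_nonempty[OF L])
        moreover have "cover_number (iterated_join X T U n) L \<le> card (nodes k L)"
          using k1 k by (intro j) (auto simp: k1_def)
        ultimately have "ln (N n) \<le> ln (real (card (nodes k L)))"
          unfolding N_def
          by (cases "cover_number (iterated_join X T U n) L = 0") (auto simp: Suc_le_eq)
        also have "\<dots> < e / real (d j) * real (time k)"
          using k0[of k] k1 pos by (simp add: k1_def pos_divide_less_eq)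
        also have "\<dots> \<le> e / real (d j) * (real n * real (d j))"
          using time_k e pos by (intro mult_left_mono) auto
        also have "\<dots> = e * real n" using pos by simp
        finally show ?thesis using pos ln_nonneg[of n] by (simp add: pos_divide_less_eq)
      qed
      then show "\<exists>no. \<forall>n\<ge>no. norm (ln (N n) / real n - 0) < e" by blast
    qed
    then have "(\<lambda>n. ereal (ln (N n) / real n)) \<longlonglongrightarrow> ereal 0"
      by (simp only: lim_ereal)
    then show ?thesis
      unfolding cover_entropy_def N_def zero_ereal_def by (intro lim_imp_Limsup) auto
  qed
  moreover have "finite_open_cover X {X}" by (simp add: finite_open_cover_def)
  ultimately show ?thesis
    unfolding topological_entropy_def by (intro SUP_eq_const) auto
qed

text \<open>
  The nodes of level \<open>k\<close> are counted by a cover of scale \<open>eps m\<close> at time \<open>time k div Suc m\<close>, which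
  multiplies a growth rate \<open>c\<close> along \<open>time k\<close> by \<open>Suc m\<close>. As \<open>m\<close> is arbitrary, any positive rate yields
  infinite entropy.
\<close>

lemma entropy_eq_infinity:
  assumes L: "L \<subseteq> limit_set" "L \<noteq> {}"
    and lim: "\<not> (\<lambda>k. ln (real (card (nodes k L))) / real (time k)) \<longlonglongrightarrow> 0"
  shows "topological_entropy X T L = \<infinity>"
proof -
  define a where "a k = ln (real (card (nodes k L))) / real (time k)" for k
  have a_nonneg: "0 \<le> a k" for k
    using nodes_nonempty[OF L, of k] by (simp add: a_def)
  obtain c where c: "0 < c" "\<And>k0. \<exists>k\<ge>k0. c \<le> a k"
    using lim a_nonneg unfolding LIMSEQ_iff a_def[symmetric] by (auto simp: not_less)
  have ge: "ereal (real (Suc m) * c) \<le> topological_entropy X T L" for m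
  proof -
    obtain U where U: "finite_open_cover X U"
      "\<And>k. m < k \<Longrightarrow> card (nodes k L) \<le> cover_number (iterated_join X T U (time k div Suc m)) L"
      using nodes_le_cover_number[of m] L(1) by blast
    define u where "u n = ereal (ln (real (cover_number (iterated_join X T U n) L)) / real n)" for n
    have "\<exists>n\<ge>n0. ereal (real (Suc m) * c) \<le> u n" for n0
    proof -
      obtain k where k: "Suc m * Suc n0 \<le> k" "c \<le> a k" using c(2) by blast
      define n where "n = time k div Suc m"
      have "Suc n0 * Suc m \<le> time k" using k(1) le_time[of k] by (simp add: algebra_simps)
      then have n: "Suc n0 \<le> n" unfolding n_def by (subst less_eq_div_iff_mult_less_eq) auto
      have "m < k" using k(1) by (metis Suc_le_lessD dual_order.trans le_add1 mult_Suc_right)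
      then have "ln (real (card (nodes k L))) \<le> ln (real (cover_number (iterated_join X T U n) L))"
        unfolding n_def using U(2)[of k] nodes_nonempty[OF L, of k] by (subst ln_le_cancel_iff) auto
      moreover have "real (Suc m) * c * real n \<le> ln (real (card (nodes k L)))"
      proof -
        have "n * Suc m \<le> time k" unfolding n_def by (rule div_times_less_eq_dividend)
        then have "real n * real (Suc m) \<le> real (time k)" by (metis of_nat_le_iff of_nat_mult)
        then have "c * (real n * real (Suc m)) \<le> c * real (time k)" using c(1) by simp
        also have "\<dots> \<le> a k * real (time k)" using k(2) by (intro mult_right_mono) auto
        also have "\<dots> = ln (real (card (nodes k L)))"
          using n by (auto simp: a_def n_def)
        finally show ?thesis by (simp add: mult_ac)
      qed
      ultimately have "real (Suc m) * c \<le> ln (real (cover_number (iterated_join X T U n) L)) / real n"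
        using n by (simp add: pos_le_divide_eq)
      then have "ereal (real (Suc m) * c) \<le> u n" by (simp add: u_def)
      moreover have "n0 \<le> n" using n by simp
      ultimately show ?thesis by blast
    qed
    then have "ereal (real (Suc m) * c) \<le> limsup u"
      unfolding limsup_INF_SUP by (intro INF_greatest) (meson SUP_upper2 atLeast_iff)
    also have "\<dots> = cover_entropy X T U L"
      by (simp add: cover_entropy_def u_def[abs_def])
    also have "\<dots> \<le> topological_entropy X T L"
      unfolding topological_entropy_def using U(1) by (intro SUP_upper) simp
    finally show ?thesis .
  qed
  show ?thesis
  proof (rule ereal_top)
    fix B :: real
    obtain m :: nat where "B / c < real m" using reals_Archimedean2 by blast
    then have "B \<le> real (Suc m) * c" using c(1) by (simp add: field_simps)
    then show "ereal B \<le> topological_entropy X T L"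
      using ge[of m] by (meson ereal_less_eq(3) order_trans)
  qed
qed

lemma entropy_limit_set: "topological_entropy X T limit_set = \<infinity>"
proof (rule entropy_eq_infinity)
  show "limit_set \<noteq> {}"
    using tree_meets_limit_set[of X 0] tree_0 by auto
  show "\<not> (\<lambda>k. ln (real (card (nodes k limit_set))) / real (time k)) \<longlonglongrightarrow> 0"
  proof
    assume "(\<lambda>k. ln (real (card (nodes k limit_set))) / real (time k)) \<longlonglongrightarrow> 0"
    then have "\<forall>\<^sub>F k in sequentially. ln (real (card (nodes k limit_set))) / real (time k) < 1"
      by (rule order_tendstoD(2)) simp
    then obtain k where k: "ln (real (card (nodes (Suc k) limit_set))) / real (time (Suc k)) < 1"
      by (auto simp: eventually_sequentially) (meson le_SucI order_refl)
    have "0 < card (tree (Suc k))"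
      using many[of k] exp_gt_zero[of "real (time (Suc k))"] by linarith
    then have "real (time (Suc k)) \<le> ln (real (card (tree (Suc k))))"
      using many[of k] by (simp add: ln_ge_iff)
    moreover have "0 < time (Suc k)" using le_time[of "Suc k"] by simp
    ultimately show False using k by (simp add: nodes_limit_set)
  qed
qed simp

lemma entropy_subset_limit_set:
  "L \<subseteq> limit_set \<Longrightarrow> L \<noteq> {} \<Longrightarrow> topological_entropy X T L \<in> {0, \<infinity>}"
  using entropy_eq_0 entropy_eq_infinity by blast

end

section \<open>Systems with an ergodic measure of infinite entropy\<close>

text \<open>
  The exponent \<open>3 * Suc m\<close> in the decay of Bowen balls compensates for their length \<open>n div Suc m\<close>: the
  measure is then at most \<open>exp (- 2 n)\<close>, in spite of the rounding. As it is
  unbounded, infinite entropy is needed to have all \<open>m\<close> at once.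
\<close>

lemma (in ergodic_system) ex_separated_tree:
  assumes ent: "measure_entropy M T = \<infinity>"
  shows "\<exists>eps d time tree. separated_tree X T eps d time tree"
proof -
  have "\<exists>e>0. (\<lambda>n. prob {x \<in> X. exp (- (3 * real (Suc m) * real n)) < prob (bowen_ball n x e)}) \<longlonglongrightarrow> 0" for m
    by (rule prob_large_bowen_balls_tendsto_0[OF ent]) simp
  then have "\<forall>m. \<exists>e. 0 < e
      \<and> (\<lambda>n. prob {x \<in> X. exp (- (3 * real (Suc m) * real n)) < prob (bowen_ball n x e)}) \<longlonglongrightarrow> 0"
    by (intro allI)
  from choice[OF this] obtain eps where eps_all: "\<forall>m. 0 < eps m
      \<and> (\<lambda>n. prob {x \<in> X. exp (- (3 * real (Suc m) * real n)) < prob (bowen_ball n x (eps m))}) \<longlonglongrightarrow> 0"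
    by (elim exE)
  note eps = eps_all[rule_format, THEN conjunct1] eps_all[rule_format, THEN conjunct2]
  have X_ne: "X \<noteq> {}" using not_empty by (simp add: space_M)
  have "\<exists>C. finite C \<and> X \<subseteq> (\<Union>c\<in>C. ball c (1 / real (Suc j)))" for j
    using compact_X unfolding compact_eq_totally_bounded by simp
  then obtain C where C: "\<And>j. finite (C j)" "\<And>j. X \<subseteq> (\<Union>c\<in>C j. ball c (1 / real (Suc j)))" by metis
  define U where "U j = (\<lambda>c. ball c (1 / real (Suc j)) \<inter> X) ` C j" for j
  have U: "finite (U j)" "U j \<subseteq> sets M" "X = \<Union>(U j)" for j
    using C[of j] borel_Int_sets by (auto simp: U_def)
  have U_small: "dist x y \<le> 2 / real (Suc j)" if u: "u \<in> U j" "x \<in> u" "y \<in> u" for j u x y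
  proof -
    obtain c where "dist c x < 1 / real (Suc j)" "dist c y < 1 / real (Suc j)"
      using u by (auto simp: U_def)
    then have "dist x y \<le> 1 / real (Suc j) + 1 / real (Suc j)"
      using dist_triangle3[of x y c] by linarith
    then show ?thesis by (simp add: add_divide_distrib[symmetric])
  qed
  \<comment> \<open>Localising orbits at all resolutions costs at most \<open>exp (n / 4 + n / 8 + \<dots>) \<le> exp (n / 2)\<close> altogether.\<close>
  define d where "d j = Suc (nat \<lceil>ln (real (card (U j))) * 2 ^ (j + 2)\<rceil>)" for j
  have d: "real (card (U j)) ^ (n div d j) \<le> exp (real n * (1 / 2) ^ (j + 2))" for j n
  proof -
    have "U j \<noteq> {}" using U(3)[of j] X_ne by auto
    then have card: "1 \<le> real (card (U j))"
      using U(1)[of j] by (simp add: Suc_le_eq card_gt_0_iff)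
    have "ln (real (card (U j))) * 2 ^ (j + 2) \<le> real (d j)"
      using real_nat_ceiling_ge[of "ln (real (card (U j))) * 2 ^ (j + 2)"] by (simp add: d_def)
    then have ln_card: "ln (real (card (U j))) \<le> real (d j) * (1 / 2) ^ (j + 2)"
      by (simp add: power_one_over field_simps)
    have "real (card (U j)) ^ (n div d j) = exp (real (n div d j) * ln (real (card (U j))))"
      using card by (simp add: exp_of_nat_mult)
    also have "real (n div d j) * ln (real (card (U j))) \<le> real n / real (d j) * (real (d j) * (1 / 2) ^ (j + 2))"
      using card by (intro mult_mono of_nat_div_le_of_nat ln_card) auto
    also have "\<dots> = real n * (1 / 2) ^ (j + 2)" by (simp add: d_def)
    finally show ?thesis by simp
  qed
  define good where "good F \<longleftrightarrow> finite F \<and> F \<noteq> {} \<and> (\<forall>V\<in>F. closed V \<and> V \<subseteq> X \<and> 0 < prob V)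
    \<and> (\<forall>V\<in>F. \<forall>W\<in>F. \<forall>x. x \<in> V \<longrightarrow> x \<in> W \<longrightarrow> V = W)" for F
  define refines where "refines k n F F' \<longleftrightarrow> (\<forall>W\<in>F'. \<exists>V\<in>F. W \<subseteq> V) \<and> (\<forall>V\<in>F. \<exists>W\<in>F'. W \<subseteq> V)
    \<and> exp (real n) \<le> real (card F')
    \<and> (\<forall>V\<in>F'. \<forall>W\<in>F'. V \<noteq> W \<longrightarrow> (\<forall>x\<in>V. \<forall>y\<in>W. \<forall>m\<le>k.
        \<exists>i < n div Suc m. eps m / 2 \<le> dist ((T ^^ i) x) ((T ^^ i) y)))
    \<and> (\<forall>V\<in>F. \<forall>W\<in>F'. \<forall>W'\<in>F'. W \<subseteq> V \<longrightarrow> W' \<subseteq> V \<longrightarrow> (\<forall>x\<in>W. \<forall>y\<in>W'. \<forall>j\<le>k.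
        \<forall>i < n div d j. dist ((T ^^ i) x) ((T ^^ i) y) \<le> 4 / real (Suc j)))" for k n F F'
  have step: "\<exists>n>n0. \<exists>F'. good F' \<and> refines k n F F'" if F: "good F" for F n0 k
  proof -
    have "\<exists>n>n0. \<exists>F'. finite F' \<and> (\<forall>W\<in>F'. closed W \<and> W \<subseteq> X \<and> 0 < prob W) \<and> refines k n F F'"
      unfolding refines_def
    proof (rule refine_tree[where U = U, OF eps U U_small d])
      show "finite F" "F \<noteq> {}" using F by (simp_all add: good_def)
      show "closed V \<and> V \<subseteq> X \<and> 0 < prob V" if "V \<in> F" for V using F that by (simp add: good_def)
      show "V = W" if "V \<in> F" "W \<in> F" "x \<in> V" "x \<in> W" for V W x using F that by (simp add: good_def)
    qed
    then obtain n F' where n: "n0 < n"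
      and F': "finite F'" "\<forall>W\<in>F'. closed W \<and> W \<subseteq> X \<and> 0 < prob W" "refines k n F F'"
      by (elim exE conjE)
    have "F' \<noteq> {}" using F F'(3) by (auto simp: good_def refines_def)
    moreover have "V = W" if VW: "V \<in> F'" "W \<in> F'" "x \<in> V" "x \<in> W" for V W x
    proof (rule ccontr)
      assume "V \<noteq> W"
      then have "\<exists>i < n div Suc 0. eps 0 / 2 \<le> dist ((T ^^ i) x) ((T ^^ i) x)"
        using F'(3) VW unfolding refines_def by blast
      then show False using eps(1)[of 0] by auto
    qed
    ultimately have "good F'" using F' by (simp add: good_def)
    with n F'(3) show ?thesis by blast
  qed
  have X_good: "good {X}"
    using compact_X X_ne prob_space by (auto simp: good_def space_M compact_imp_closed)
  have "\<exists>f. \<forall>k. (good (snd (f k)) \<and> (k = 0 \<longrightarrow> snd (f k) = {X}))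
      \<and> (fst (f k) < fst (f (Suc k)) \<and> refines k (fst (f (Suc k))) (snd (f k)) (snd (f (Suc k))))"
  proof (rule dependent_nat_choice)
    show "\<exists>x :: nat \<times> 'a set set. good (snd x) \<and> (0 = (0::nat) \<longrightarrow> snd x = {X})"
      using X_good by (intro exI[of _ "(0 :: nat, {X})"]) simp
  next
    fix x :: "nat \<times> 'a set set" and k :: nat
    assume "good (snd x) \<and> (k = 0 \<longrightarrow> snd x = {X})"
    then obtain n F' where "fst x < n" "good F'" "refines k n (snd x) F'"
      using step[of "snd x" "fst x" k] by blast
    then show "\<exists>y. (good (snd y) \<and> (Suc k = 0 \<longrightarrow> snd y = {X}))
        \<and> (fst x < fst y \<and> refines k (fst y) (snd x) (snd y))"
      by (intro exI[of _ "(n, F')"]) simp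
  qed
  then obtain f where f: "\<forall>k. (good (snd (f k)) \<and> (k = 0 \<longrightarrow> snd (f k) = {X}))
      \<and> (fst (f k) < fst (f (Suc k)) \<and> refines k (fst (f (Suc k))) (snd (f k)) (snd (f (Suc k))))"
    by (elim exE)
  define time where "time k = fst (f k)" for k
  define tree where "tree k = snd (f k)" for k
  have good: "good (tree k)" and tree_0: "tree 0 = {X}" and less: "time k < time (Suc k)"
    and ref: "refines k (time (Suc k)) (tree k) (tree (Suc k))" for k
    using f by (simp_all add: time_def tree_def)
  have up: "\<forall>W\<in>tree (Suc k). \<exists>V\<in>tree k. W \<subseteq> V"
    and down: "\<forall>V\<in>tree k. \<exists>W\<in>tree (Suc k). W \<subseteq> V"
    and many: "exp (real (time (Suc k))) \<le> real (card (tree (Suc k)))"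
    and sep: "\<forall>V\<in>tree (Suc k). \<forall>W\<in>tree (Suc k). V \<noteq> W \<longrightarrow> (\<forall>x\<in>V. \<forall>y\<in>W. \<forall>m\<le>k.
        \<exists>i < time (Suc k) div Suc m. eps m / 2 \<le> dist ((T ^^ i) x) ((T ^^ i) y))"
    and clus: "\<forall>V\<in>tree k. \<forall>W\<in>tree (Suc k). \<forall>W'\<in>tree (Suc k). W \<subseteq> V \<longrightarrow> W' \<subseteq> V \<longrightarrow>
        (\<forall>x\<in>W. \<forall>y\<in>W'. \<forall>j\<le>k. \<forall>i < time (Suc k) div d j.
          dist ((T ^^ i) x) ((T ^^ i) y) \<le> 4 / real (Suc j))" for k
    using ref[of k, unfolded refines_def] by - (elim conjE, assumption)+
  have "separated_tree X T eps d time tree"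
  proof
    show "strict_mono time" using less by (simp add: strict_mono_Suc_iff)
    show "finite (tree k)" for k using good[of k] by (simp add: good_def)
    show "closed V" "V \<noteq> {}" if "V \<in> tree k" for k V using good[of k] that by (auto simp: good_def)
    show "\<exists>V\<in>tree k. W \<subseteq> V" if "W \<in> tree (Suc k)" for k W
      by (rule up[rule_format, OF that])
    show "\<exists>W\<in>tree (Suc k). W \<subseteq> V" if "V \<in> tree k" for k V
      by (rule down[rule_format, OF that])
    show "exp (real (time (Suc k))) \<le> real (card (tree (Suc k)))" for k
      by (rule many)
    show "\<exists>i < time k div Suc m. eps m / 2 \<le> dist ((T ^^ i) x) ((T ^^ i) y)"
      if VW: "V \<in> tree k" "W \<in> tree k" "V \<noteq> W" "x \<in> V" "y \<in> W" "m < k" for k V W x y m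
    proof -
      obtain k' where k': "k = Suc k'" "m \<le> k'" using VW(6) by (cases k) auto
      show ?thesis
        using VW(1-3) unfolding k'(1) by (rule sep[rule_format, OF _ _ _ VW(4,5) k'(2)])
    qed
    show "dist ((T ^^ i) x) ((T ^^ i) y) \<le> 4 / real (Suc j)"
      if "V \<in> tree k" "W \<in> tree (Suc k)" "W' \<in> tree (Suc k)" "W \<subseteq> V" "W' \<subseteq> V"
        "x \<in> W" "y \<in> W'" "j \<le> k" "i < time (Suc k) div d j" for k V W W' x y j i
      by (rule clus[rule_format, OF that])
  qed (use compact_X T_in eps(1) tree_0 in \<open>auto simp: d_def\<close>)
  then show ?thesis by blast
qed

theorem theorem1p4:
  fixes X :: "'a::metric_space set" and T :: "'a \<Rightarrow> 'a"
  assumes "topological_dynamical_system X T"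
    and "\<exists>\<mu>. borel_probability_on X \<mu> \<and> ergodic_measure \<mu> T \<and> measure_entropy \<mu> T = \<infinity>"
  shows "\<not> hereditarily_lowerable X T \<and>
    (\<exists>K. compact K \<and> K \<noteq> {} \<and> K \<subseteq> X \<and> topological_entropy X T K = \<infinity> \<and>
      (\<forall>L. compact L \<and> L \<noteq> {} \<and> L \<subseteq> K \<longrightarrow> topological_entropy X T L \<in> {0, \<infinity>}))"
proof -
  obtain S where compact: "compact X" and S: "homeomorphism X X T S"
    using assms(1) by (auto simp: topological_dynamical_system_def)
  obtain \<mu> where \<mu>: "borel_probability_on X \<mu>" "ergodic_measure \<mu> T" "measure_entropy \<mu> T = \<infinity>"
    using assms(2) by blast
  interpret prob_space \<mu> using \<mu>(1) by (simp add: borel_probability_on_def)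
  interpret ergodic_system \<mu> X T
    using compact S \<mu>
    by unfold_locales (auto simp: homeomorphism_def borel_probability_on_def ergodic_measure_def invariant_measure_def)
  obtain eps d time tree where "separated_tree X T eps d time tree"
    using ex_separated_tree[OF \<mu>(3)] by blast
  then interpret separated_tree X T eps d time tree .
  have K: "compact limit_set \<and> limit_set \<noteq> {} \<and> limit_set \<subseteq> X \<and> topological_entropy X T limit_set = \<infinity>"
    using compact_limit_set limit_set_subset entropy_limit_set tree_meets_limit_set[of X 0] tree_0 by auto
  moreover have "topological_entropy X T L \<in> {0, \<infinity>}" if "L \<noteq> {}" "L \<subseteq> limit_set" for L
    by (rule entropy_subset_limit_set[OF that(2,1)])
  moreover have "\<not> hereditarily_lowerable X T"
  proof
    assume "hereditarily_lowerable X T"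
    then have "\<exists>L. compact L \<and> L \<noteq> {} \<and> L \<subseteq> limit_set \<and> topological_entropy X T L = 1"
      using K unfolding hereditarily_lowerable_def by (metis ereal_less_eq(1) zero_less_one_ereal less_imp_le)
    then obtain L where L: "L \<noteq> {}" "L \<subseteq> limit_set" "topological_entropy X T L = 1" by blast
    show False using entropy_subset_limit_set[OF L(2,1)] L(3) by simp
  qed
  ultimately show ?thesis by blast
qed

end
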